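(* Let $\psi:F\to R^\times$ be a non-trivial smooth character. Up to isomorphism, there exists a unique irreducible representation $(\rho_\psi,S)$ in $\mathrm{Rep}_R(H)$ whose central character is $\psi$.
   Context: $F$ is a field which is either finite of characteristic $p$, or non-archimedean local of residual characteristic $p$; in all cases the characteristic of $F$ is different from $2$. $(W,\langle\,,\rangle)$ is a symplectic space of finite dimension over $F$. $R$ is a field of characteristic $\ell$ such that there exists a non-trivial smooth (i.e. locally constant) additive character $\psi:F\to R^\times$ (this forces $\ell\neq p$). The Heisenberg group $H$ is the set $W\times F$ with the product topology and the group law $(w,t)\cdot(w',t')=\left(w+w',\,t+t'+\tfrac{\langle w,w'\rangle}{2}\right)$; it is locally profinite. $F$ is identified with the centre of $H$ via $t\mapsto(0,t)$. For a locally profinite group $G$, $\mathrm{Rep}_R(G)$ denotes the category of smooth representations of $G$ on $R$-vector spaces. A representation of $H$ has central character $\psi$ if $(0,t)$ acts by the scalar $\psi(t)$ for all $t\in F$. *)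

theory Defs
  imports
    "HOL-Analysis.Analysis"
    "HOL-Algebra.QuotRing"
    "HOL-Library.Function_Algebras"
begin

section \<open>The base field\<close>

definition nonarch_abs :: "('f::field \<Rightarrow> real) \<Rightarrow> bool" where
  "nonarch_abs v \<longleftrightarrow>
     (\<forall>x. 0 \<le> v x) \<and> (\<forall>x. v x = 0 \<longleftrightarrow> x = 0) \<and>
     (\<forall>x y. v (x * y) = v x * v y) \<and> (\<forall>x y. v (x + y) \<le> max (v x) (v y))"

definition abs_dist :: "('f::field \<Rightarrow> real) \<Rightarrow> 'f \<Rightarrow> 'f \<Rightarrow> real" where
  "abs_dist v x y = v (x - y)"

definition abs_topology :: "('f::field \<Rightarrow> real) \<Rightarrow> 'f topology" where
  "abs_topology v = Metric_space.mtopology UNIV (abs_dist v)"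

definition valuation_ring :: "('f::field \<Rightarrow> real) \<Rightarrow> 'f ring" where
  "valuation_ring v =
     \<lparr>carrier = {x. v x \<le> 1}, mult = (*), one = 1, zero = 0, add = (+)\<rparr>"

definition residue_field :: "('f::field \<Rightarrow> real) \<Rightarrow> 'f set ring" where
  "residue_field v = valuation_ring v Quot {x. v x < 1}"

definition ring_has_char :: "('a, 'b) ring_scheme \<Rightarrow> nat \<Rightarrow> bool" where
  "ring_has_char A n \<longleftrightarrow> (\<forall>k::nat. add_pow A k \<one>\<^bsub>A\<^esub> = \<zero>\<^bsub>A\<^esub> \<longleftrightarrow> n dvd k)"

text \<open>A field complete with respect to a discrete (hence non-trivial) valuation, with finite
  residue field; archimedean local fields are excluded by \<^const>\<open>nonarch_abs\<close>.\<close>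

definition nonarch_local_field :: "('f::field \<Rightarrow> real) \<Rightarrow> bool" where
  "nonarch_local_field v \<longleftrightarrow>
     nonarch_abs v \<and>
     (\<exists>u. 0 < v u \<and> v u < 1 \<and> (\<forall>x. x \<noteq> 0 \<longrightarrow> (\<exists>n::int. v x = v u powi n))) \<and>
     Metric_space.mcomplete UNIV (abs_dist v) \<and>
     finite (carrier (residue_field v))"

definition base_field :: "'f::field topology \<Rightarrow> nat \<Rightarrow> bool" where
  "base_field T p \<longleftrightarrow>
     (finite (UNIV :: 'f set) \<and> CHAR('f) = p \<and> T = discrete_topology UNIV) \<or>
     (\<exists>v. nonarch_local_field v \<and> ring_has_char (residue_field v) p \<and> T = abs_topology v)"

definition smooth_character :: "'f::field topology \<Rightarrow> ('f \<Rightarrow> 'r::field) \<Rightarrow> bool" where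
  "smooth_character T \<psi> \<longleftrightarrow>
     (\<forall>x. \<psi> x \<noteq> 0) \<and> (\<forall>x y. \<psi> (x + y) = \<psi> x * \<psi> y) \<and>
     (\<forall>x. \<exists>U. openin T U \<and> x \<in> U \<and> (\<forall>y\<in>U. \<psi> y = \<psi> x))"

section \<open>The symplectic space and its Heisenberg group\<close>

definition symplectic_form ::
  "('f::field \<Rightarrow> 'w::ab_group_add \<Rightarrow> 'w) \<Rightarrow> ('w \<Rightarrow> 'w \<Rightarrow> 'f) \<Rightarrow> bool" where
  "symplectic_form scaleW form \<longleftrightarrow>
     (\<forall>w. Vector_Spaces.linear scaleW (*) (\<lambda>w'. form w w')) \<and>
     (\<forall>w'. Vector_Spaces.linear scaleW (*) (\<lambda>w. form w w')) \<and>
     (\<forall>w. form w w = 0) \<and>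
     (\<forall>w. (\<forall>w'. form w w' = 0) \<longrightarrow> w = 0)"

text \<open>The topology of a finite-dimensional space, transported from the product topology on
  coordinate vectors; it does not depend on the basis \<open>B\<close>.\<close>

definition coord_topology ::
  "('f::field \<Rightarrow> 'w::ab_group_add \<Rightarrow> 'w) \<Rightarrow> 'w set \<Rightarrow> 'f topology \<Rightarrow> 'w topology" where
  "coord_topology scaleW B T =
     pullback_topology UNIV (\<lambda>w. \<lambda>b\<in>B. module.representation scaleW B w b)
       (product_topology (\<lambda>_. T) B)"

definition heisenberg :: "('w::ab_group_add \<Rightarrow> 'w \<Rightarrow> 'f::field) \<Rightarrow> ('w \<times> 'f) monoid" where
  "heisenberg form =
     \<lparr>carrier = UNIV,
      mult = (\<lambda>(w, t) (w', t'). (w + w', t + t' + form w w' / 2)),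
      one = (0, 0)\<rparr>"

definition heisenberg_topology ::
  "('f::field \<Rightarrow> 'w::ab_group_add \<Rightarrow> 'w) \<Rightarrow> 'w set \<Rightarrow> 'f topology \<Rightarrow> ('w \<times> 'f) topology" where
  "heisenberg_topology scaleW B T = prod_topology (coord_topology scaleW B T) T"

section \<open>Smooth representations\<close>

text \<open>The space of a representation is a subspace \<open>V\<close> of an ambient vector space, so that
  representation spaces need not exhaust a type; \<open>\<pi> g\<close> is only constrained on \<open>V\<close>.\<close>

definition group_rep ::
  "('g, 'b) monoid_scheme \<Rightarrow> ('r::field \<Rightarrow> 'v::ab_group_add \<Rightarrow> 'v) \<Rightarrow> 'v set \<Rightarrow>
   ('g \<Rightarrow> 'v \<Rightarrow> 'v) \<Rightarrow> bool" where
  "group_rep G scl V \<pi> \<longleftrightarrow>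
     vector_space scl \<and> module.subspace scl V \<and>
     (\<forall>g\<in>carrier G. \<forall>x\<in>V. \<pi> g x \<in> V) \<and>
     (\<forall>g\<in>carrier G. \<forall>x\<in>V. \<forall>y\<in>V. \<pi> g (x + y) = \<pi> g x + \<pi> g y) \<and>
     (\<forall>g\<in>carrier G. \<forall>c. \<forall>x\<in>V. \<pi> g (scl c x) = scl c (\<pi> g x)) \<and>
     (\<forall>x\<in>V. \<pi> \<one>\<^bsub>G\<^esub> x = x) \<and>
     (\<forall>g\<in>carrier G. \<forall>h\<in>carrier G. \<forall>x\<in>V. \<pi> (g \<otimes>\<^bsub>G\<^esub> h) x = \<pi> g (\<pi> h x))"

definition smooth_rep ::
  "('g, 'b) monoid_scheme \<Rightarrow> 'g topology \<Rightarrow> ('r::field \<Rightarrow> 'v::ab_group_add \<Rightarrow> 'v) \<Rightarrow> 'v set \<Rightarrow>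
   ('g \<Rightarrow> 'v \<Rightarrow> 'v) \<Rightarrow> bool" where
  "smooth_rep G TG scl V \<pi> \<longleftrightarrow>
     group_rep G scl V \<pi> \<and> (\<forall>x\<in>V. openin TG {g \<in> carrier G. \<pi> g x = x})"

definition irreducible_rep ::
  "('g, 'b) monoid_scheme \<Rightarrow> ('r::field \<Rightarrow> 'v::ab_group_add \<Rightarrow> 'v) \<Rightarrow> 'v set \<Rightarrow>
   ('g \<Rightarrow> 'v \<Rightarrow> 'v) \<Rightarrow> bool" where
  "irreducible_rep G scl V \<pi> \<longleftrightarrow>
     V \<noteq> {0} \<and>
     (\<forall>U. U \<subseteq> V \<and> module.subspace scl U \<and> (\<forall>g\<in>carrier G. \<forall>x\<in>U. \<pi> g x \<in> U) \<longrightarrow>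
          U = {0} \<or> U = V)"

definition isomorphic_reps ::
  "('g, 'b) monoid_scheme \<Rightarrow>
   ('r::field \<Rightarrow> 'v::ab_group_add \<Rightarrow> 'v) \<Rightarrow> 'v set \<Rightarrow> ('g \<Rightarrow> 'v \<Rightarrow> 'v) \<Rightarrow>
   ('r \<Rightarrow> 'u::ab_group_add \<Rightarrow> 'u) \<Rightarrow> 'u set \<Rightarrow> ('g \<Rightarrow> 'u \<Rightarrow> 'u) \<Rightarrow> bool" where
  "isomorphic_reps G scl V \<pi> scl' V' \<pi>' \<longleftrightarrow>
     (\<exists>f. bij_betw f V V' \<and>
          (\<forall>x\<in>V. \<forall>y\<in>V. f (x + y) = f x + f y) \<and>
          (\<forall>c. \<forall>x\<in>V. f (scl c x) = scl' c (f x)) \<and>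
          (\<forall>g\<in>carrier G. \<forall>x\<in>V. f (\<pi> g x) = \<pi>' g (f x)))"

definition has_central_character ::
  "('f \<Rightarrow> 'r::field) \<Rightarrow> ('r \<Rightarrow> 'v \<Rightarrow> 'v) \<Rightarrow> 'v set \<Rightarrow>
   ('w::ab_group_add \<times> 'f \<Rightarrow> 'v \<Rightarrow> 'v) \<Rightarrow> bool" where
  "has_central_character \<psi> scl V \<pi> \<longleftrightarrow> (\<forall>t. \<forall>x\<in>V. \<pi> (0, t) x = scl (\<psi> t) x)"

definition irreducible_heisenberg_rep ::
  "('f::field \<Rightarrow> 'w::ab_group_add \<Rightarrow> 'w) \<Rightarrow> 'w set \<Rightarrow> 'f topology \<Rightarrow> ('w \<Rightarrow> 'w \<Rightarrow> 'f) \<Rightarrow>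
   ('f \<Rightarrow> 'r::field) \<Rightarrow> ('r \<Rightarrow> 'v::ab_group_add \<Rightarrow> 'v) \<Rightarrow> 'v set \<Rightarrow> ('w \<times> 'f \<Rightarrow> 'v \<Rightarrow> 'v) \<Rightarrow> bool" where
  "irreducible_heisenberg_rep scaleW B T form \<psi> scl V \<pi> \<longleftrightarrow>
     smooth_rep (heisenberg form) (heisenberg_topology scaleW B T) scl V \<pi> \<and>
     irreducible_rep (heisenberg form) scl V \<pi> \<and>
     has_central_character \<psi> scl V \<pi>"

text \<open>Types cannot be quantified existentially, so existence is asserted inside the space of all
  functions \<open>H \<rightarrow> R\<close>, where induced representations live, with pointwise scaling.\<close>

definition fun_scale :: "'r::field \<Rightarrow> ('h \<Rightarrow> 'r) \<Rightarrow> 'h \<Rightarrow> 'r" where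
  "fun_scale c \<phi> = (\<lambda>h. c * \<phi> h)"

end

theory Submission
  imports Defs
begin

text \<open>With respect to a symplectic basis, \<open>W\<close> carries a biadditive \<open>\<beta>\<close> whose antisymmetrization is the
  symplectic form, so representations of \<open>H\<close> with central character \<open>\<psi>\<close> are the projective
  representations \<open>A\<close> of \<open>W\<close> with cocycle \<open>\<psi> \<circ> (- \<beta>)\<close>. There is a lattice \<open>L\<close> on which the cocycle is
  trivial and which is its own annihilator under the commutator pairing. Two facts give everything.
  A non-zero smooth representation contains a non-zero vector fixed by \<open>L\<close>: characters of the finite
  quotients of \<open>L\<close> separate points and are all induced by elements of \<open>W\<close>, which can be used to move
  an eigenvector to a fixed vector. And if \<open>v\<close> is fixed by \<open>L\<close>, then the fixed vectors in the
  representation generated by \<open>v\<close> are the multiples of \<open>v\<close>, since \<open>A w v\<close> has a non-trivial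
  eigencharacter for \<open>w \<notin> L\<close>. Hence a representation generated by a fixed vector is irreducible, and
  two irreducible ones are identified by the graph generated by a pair of fixed vectors.\<close>

section \<open>Twisted representations of a group with a self-dual lattice\<close>

text \<open>Two obstacles shape the proof. First, \<open>R\<close> is an arbitrary field, so
  eigenvectors of a commuting family cannot be taken for granted: the only characters certain to
  have values in \<open>R\<close> are the \<open>\<psi> (form _ w)\<close>, and points of the finite
  quotients are separated with these alone. Second, the residual characteristic may be 2. The factor
  1/2 in the group law is then not integral, and the natural cocycle
  \<open>\<psi> (form w w' / 2)\<close> may be non-trivial on a self-dual lattice. Passing from
  \<open>(w, 0)\<close> to \<open>(w, q w)\<close> changes it by a coboundary into
  \<open>\<psi> (- \<beta> w w')\<close>, where \<open>\<beta>\<close> pairs the two halves of the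
  coordinates and involves no halving. The halving survives only in \<open>q\<close>, where it is a
  matter of choosing smaller neighbourhoods. The algebra is developed without topology: open
  subgroups of the lattice enter only through finite index and separation of points.\<close>

locale polarized_bicharacter =
  fixes \<kappa> :: "'w::ab_group_add \<Rightarrow> 'w \<Rightarrow> 'r::field" and L :: "'w set"
  assumes nonzero: "\<kappa> w w' \<noteq> 0"
    and add_left: "\<kappa> (w + w') z = \<kappa> w z * \<kappa> w' z"
    and add_right: "\<kappa> z (w + w') = \<kappa> z w * \<kappa> z w'"
    and L_zero: "0 \<in> L"
    and L_add: "l \<in> L \<Longrightarrow> l' \<in> L \<Longrightarrow> l + l' \<in> L"
    and L_uminus: "l \<in> L \<Longrightarrow> - l \<in> L"
    and trivial_on_L: "l \<in> L \<Longrightarrow> l' \<in> L \<Longrightarrow> \<kappa> l l' = 1"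
    and self_dual: "(\<And>l. l \<in> L \<Longrightarrow> \<kappa> l w = \<kappa> w l) \<Longrightarrow> w \<in> L"
begin

text \<open>The scalar by which \<open>A w\<close> and \<open>A w'\<close> fail to commute. It is 1
  on \<open>L\<close> by \<open>trivial_on_L\<close>, so together with \<open>self_dual\<close> the
  lattice equals its annihilator.\<close>

definition comm :: "'w \<Rightarrow> 'w \<Rightarrow> 'r" where
  "comm w w' = \<kappa> w w' / \<kappa> w' w"

lemma comm_nonzero: "comm w w' \<noteq> 0"
  by (simp add: comm_def nonzero)

lemma comm_add_left: "comm (w + w') z = comm w z * comm w' z"
  by (simp add: comm_def add_left add_right)

lemma comm_add_right: "comm z (w + w') = comm z w * comm z w'"
  by (simp add: comm_def add_left add_right)

lemma comm_zero_right [simp]: "comm z 0 = 1"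
  using comm_add_right[of z 0 0] comm_nonzero[of z 0] by simp

lemma comm_eq_1_iff: "comm w w' = 1 \<longleftrightarrow> \<kappa> w w' = \<kappa> w' w"
  by (simp add: comm_def nonzero)

lemma L_diff: "l \<in> L \<Longrightarrow> l' \<in> L \<Longrightarrow> l - l' \<in> L"
  using L_add[of l "- l'"] L_uminus[of l'] by simp

end

text \<open>A projective action with prescribed cocycle. It lives on a subspace of the ambient type,
  so a stable subspace is again an instance with the same \<open>A\<close>.\<close>

locale twisted_rep = polarized_bicharacter \<kappa> L + vector_space scl
  for \<kappa> :: "'w::ab_group_add \<Rightarrow> 'w \<Rightarrow> 'r::field" and L
    and scl :: "'r \<Rightarrow> 'v::ab_group_add \<Rightarrow> 'v" +
  fixes V :: "'v set" and A :: "'w \<Rightarrow> 'v \<Rightarrow> 'v"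
  assumes V_subspace: "subspace V"
    and A_in: "x \<in> V \<Longrightarrow> A w x \<in> V"
    and A_add: "x \<in> V \<Longrightarrow> y \<in> V \<Longrightarrow> A w (x + y) = A w x + A w y"
    and A_scale: "x \<in> V \<Longrightarrow> A w (scl c x) = scl c (A w x)"
    and A_zero: "x \<in> V \<Longrightarrow> A 0 x = x"
    and A_mult: "x \<in> V \<Longrightarrow> A w (A w' x) = scl (\<kappa> w w') (A (w + w') x)"
begin

definition fixed :: "'v \<Rightarrow> bool" where
  "fixed v \<longleftrightarrow> v \<in> V \<and> (\<forall>l\<in>L. A l v = v)"

definition stable :: "'v set \<Rightarrow> bool" where
  "stable U \<longleftrightarrow> U \<subseteq> V \<and> subspace U \<and> (\<forall>w. \<forall>x\<in>U. A w x \<in> U)"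

definition orbit :: "'v \<Rightarrow> 'v set" where
  "orbit v = range (\<lambda>w. A w v)"

lemma A_0: "A w 0 = 0"
  using A_scale[of 0 w 0] subspace_0[OF V_subspace] by simp

lemma A_sum: "(\<And>i. i \<in> I \<Longrightarrow> f i \<in> V) \<Longrightarrow> A w (\<Sum>i\<in>I. f i) = (\<Sum>i\<in>I. A w (f i))"
proof (induction I rule: infinite_finite_induct)
  case (insert i I)
  then have "(\<Sum>i\<in>I. f i) \<in> V" by (intro subspace_sum[OF V_subspace]) auto
  with insert show ?case by (simp add: A_add)
qed (auto simp: A_0)

lemma A_comm: "x \<in> V \<Longrightarrow> A w (A w' x) = scl (comm w w') (A w' (A w x))"
  using nonzero[of w' w] by (simp add: A_mult comm_def add.commute)

lemma A_nonzero:
  assumes "x \<in> V" "x \<noteq> 0" shows "A w x \<noteq> 0"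
proof
  assume "A w x = 0"
  then have "A (- w) (A w x) = 0" by (simp add: A_0)
  then show False using assms nonzero[of "- w" w] by (simp add: A_mult A_zero)
qed

lemma A_in_span:
  assumes "G \<subseteq> V" "\<And>x. x \<in> G \<Longrightarrow> A w x \<in> span G" "x \<in> span G"
  shows "A w x \<in> span G"
proof -
  have "subspace {x \<in> V. A w x \<in> span G}"
    using V_subspace
    by (auto simp: subspace_def A_add A_scale A_0 span_add span_scale span_zero)
  then have "span G \<subseteq> {x \<in> V. A w x \<in> span G}"
    using assms by (intro span_minimal) auto
  then show ?thesis using assms(3) by auto
qed

lemma span_orbit_subset:
  assumes "stable U" "v \<in> U" shows "span (orbit v) \<subseteq> U"
  using assms by (intro span_minimal) (auto simp: orbit_def stable_def)

lemma stable_V: "stable V"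
  using V_subspace A_in by (auto simp: stable_def)

lemma orbit_base: "v \<in> V \<Longrightarrow> v \<in> span (orbit v)"
  by (rule span_base) (metis A_zero orbit_def rangeI)

lemma stable_span_orbit:
  assumes "v \<in> V" shows "stable (span (orbit v))"
proof -
  have sub: "span (orbit v) \<subseteq> V" by (rule span_orbit_subset[OF stable_V assms])
  have "A w x \<in> span (orbit v)" if x: "x \<in> orbit v" for w x
  proof -
    obtain w' where "x = A w' v" using x by (auto simp: orbit_def)
    then have "A w x = scl (\<kappa> w w') (A (w + w') v)" using assms by (simp only: A_mult)
    moreover have "A (w + w') v \<in> orbit v" by (simp add: orbit_def)
    ultimately show ?thesis by (simp add: span_base span_scale)
  qed
  moreover have "orbit v \<subseteq> V" using assms by (auto simp: orbit_def intro: A_in)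
  ultimately have "A w x \<in> span (orbit v)" if "x \<in> span (orbit v)" for w x
    using that by (blast intro: A_in_span)
  then show ?thesis using sub by (auto simp: stable_def)
qed

text \<open>The vectors \<^term>\<open>A w v\<close> are eigenvectors of \<open>L\<close>, and by self-duality those with
  \<^term>\<open>w \<notin> L\<close> have non-trivial eigencharacters; they are removed one at a time.\<close>

lemma fixed_in_span_orbit:
  assumes v: "fixed v" and u: "fixed u" "u \<in> span (orbit v)"
  shows "u \<in> span {v}"
proof -
  have vV: "v \<in> V" using v by (auto simp: fixed_def)
  have main: "u \<in> span {v}" if "finite I" "u \<in> span (insert v ((\<lambda>w. A w v) ` I))" for I
    using that
  proof (induction I rule: finite_induct)
    case (insert w I)
    let ?S = "insert v ((\<lambda>w. A w v) ` I)"
    have S: "?S \<subseteq> V" using vV A_in by auto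
    have "u \<in> span ?S"
    proof (cases "w \<in> L")
      case True
      then have "A w v = v" using v by (auto simp: fixed_def)
      then show ?thesis using insert.prems by (simp add: insert_commute)
    next
      case False
      \<comment> \<open>By self-duality some \<open>l\<close> in the lattice acts on
        \<open>A w v\<close> by a scalar other than 1.\<close>
      then obtain l where l: "l \<in> L" "comm l w \<noteq> 1"
        using self_dual comm_eq_1_iff by metis
      obtain k where k: "u - scl k (A w v) \<in> span ?S"
        using insert.prems by (metis image_insert insert_commute span_breakdown_eq)
      define s where "s = u - scl k (A w v)"
      have sS: "s \<in> span ?S" using k by (simp add: s_def)
      have spanV: "span ?S \<subseteq> V" by (rule span_minimal[OF S V_subspace])
      have eig: "A l (A w' v) = scl (comm l w') (A w' v)" for w'
        using v l vV by (simp add: A_comm fixed_def)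
      have lS: "A l x \<in> span ?S" if "x \<in> span ?S" for x
      proof (rule A_in_span[OF S _ that])
        fix y assume "y \<in> ?S"
        then consider "y = v" | w' where "w' \<in> I" "y = A w' v" by auto
        then show "A l y \<in> span ?S"
        proof cases
          case 1
          then show ?thesis using v l by (auto simp: fixed_def intro: span_base)
        next
          case 2
          then show ?thesis by (auto simp: eig intro!: span_scale intro: span_base)
        qed
      qed
      have sV: "s \<in> V" using sS spanV by auto
      have u_eq: "u = s + scl k (A w v)" by (simp add: s_def)
      have AwV: "A w v \<in> V" using vV A_in by auto
      \<comment> \<open>The operator \<open>A l - comm l w\<close> kills the component along
        \<open>A w v\<close>, preserves the span of the other vectors, and multiplies the fixed
        vector \<open>u\<close> by \<open>1 - comm l w\<close>, which is invertible.\<close>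
      have "u = A l u" using u l by (simp add: fixed_def)
      also have "\<dots> = A l s + scl (comm l w) (scl k (A w v))"
        using sV AwV V_subspace by (subst u_eq) (simp add: A_add A_scale subspace_scale eig mult.commute)
      also have "scl k (A w v) = u - s" by (simp add: s_def)
      finally have "u - scl (comm l w) u = A l s - scl (comm l w) s"
        by (simp add: algebra_simps)
      then have "scl (1 - comm l w) u = A l s - scl (comm l w) s"
        by (simp add: scale_left_diff_distrib)
      then have "scl (inverse (1 - comm l w)) (scl (1 - comm l w) u)
          = scl (inverse (1 - comm l w)) (A l s - scl (comm l w) s)" by simp
      then have "u = scl (inverse (1 - comm l w)) (A l s - scl (comm l w) s)"
        using l(2) by simp
      then show ?thesis
        using sS lS[OF sS] by (metis span_diff span_scale)
    qed
    then show ?case by (rule insert.IH)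
  qed simp
  obtain S r where S: "finite S" "S \<subseteq> orbit v" "u = (\<Sum>a\<in>S. scl (r a) a)"
    using u(2) unfolding span_explicit by blast
  have "u \<in> span S" unfolding S(3) by (intro span_sum span_scale span_base)
  moreover obtain I where I: "finite I" "S = (\<lambda>w. A w v) ` I"
    using finite_subset_image[OF S(1)] S(2) unfolding orbit_def by blast
  ultimately have "u \<in> span (insert v ((\<lambda>w. A w v) ` I))"
    using span_mono[OF subset_insertI] by blast
  then show ?thesis by (rule main[OF I(1)])
qed

end

section \<open>Existence of vectors fixed by the lattice\<close>

context polarized_bicharacter begin

text \<open>Algebraic substitute for an open subgroup of the lattice: the quotient is finite, and
  its points are separated by characters \<open>comm _ w\<close>, which always have values in
  \<open>R\<close>.\<close>

definition finite_level :: "'w set \<Rightarrow> bool" where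
  "finite_level M \<longleftrightarrow> M \<subseteq> L \<and> 0 \<in> M \<and> (\<forall>x\<in>M. \<forall>y\<in>M. x - y \<in> M) \<and>
     (\<exists>I. finite I \<and> (\<forall>l\<in>L. \<exists>i\<in>I. l - i \<in> M)) \<and>
     (\<forall>l\<in>L - M. \<exists>w. comm l w \<noteq> 1 \<and> (\<forall>m\<in>M. comm m w = 1))"

end

context twisted_rep begin

text \<open>The characters \<open>comm _ w\<close> of the finite group \<open>L / M\<close> separate its points, so a product of
  factors \<open>comm _ w - comm g w\<close> is a non-zero multiple of the delta function at \<open>0\<close>. If all the
  \<open>L\<close>-eigenvectors \<open>T (\<lambda>j. comm j w)\<close> vanished, so would \<open>v\<close>. Unlike averaging, this does not divide
  by the order of \<open>L / M\<close>.\<close>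

lemma exists_fixed:
  assumes M: "finite_level M" and v: "v \<in> V" "v \<noteq> 0" "\<And>m. m \<in> M \<Longrightarrow> A m v = v"
  shows "\<exists>u. fixed u \<and> u \<noteq> 0 \<and> u \<in> span (orbit v)"
proof -
  obtain I where I: "finite I" "\<And>l. l \<in> L \<Longrightarrow> \<exists>i\<in>I. l - i \<in> M"
    using M unfolding finite_level_def by blast
  have M_sub: "M \<subseteq> L" and M0: "0 \<in> M" and Mdiff: "\<And>x y. x \<in> M \<Longrightarrow> y \<in> M \<Longrightarrow> x - y \<in> M"
    using M by (auto simp: finite_level_def)
  have Madd: "x + y \<in> M" if "x \<in> M" "y \<in> M" for x y
    using Mdiff[OF that(1) Mdiff[OF M0 that(2)]] by simp
  \<comment> \<open>\<open>I\<close> may contain several representatives of a class, or points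
    outside \<open>L\<close>. The choice \<open>s l\<close> depends only on the class of
    \<open>l\<close> (\<open>s_cong\<close>), so its image \<open>J\<close> is an exact transversal
    of \<open>L / M\<close>.\<close>
  define s where "s l = (SOME i. i \<in> I \<and> l - i \<in> M)" for l
  have s: "s l \<in> I" "l - s l \<in> M" if "l \<in> L" for l
    using someI_ex[of "\<lambda>i. i \<in> I \<and> l - i \<in> M"] I(2)[OF that] by (auto simp: s_def)
  have sL: "s l \<in> L" if "l \<in> L" for l
    using L_diff[OF that, of "l - s l"] s(2)[OF that] M_sub by auto
  have s_cong: "s l = s l'" if "l - l' \<in> M" for l l'
  proof -
    have "l - i \<in> M \<longleftrightarrow> l' - i \<in> M" for i
      using Mdiff[of "l - i" "l - l'"] Madd[of "l - l'" "l' - i"] that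
      by (auto simp: algebra_simps)
    then show ?thesis by (simp add: s_def)
  qed
  define J where "J = s ` L"
  have J: "finite J" "J \<subseteq> L"
    using I(1) s(1) sL by (auto simp: J_def intro: finite_subset)
  have s_idem: "s j = j" if "j \<in> J" for j
  proof -
    obtain l where l: "l \<in> L" "j = s l" using \<open>j \<in> J\<close> by (auto simp: J_def)
    then show ?thesis using s_cong[OF s(2)] by simp
  qed
  have s_in: "s l \<in> J" if "l \<in> L" for l using that by (simp add: J_def)
  \<comment> \<open>For \<open>f = comm _ w\<close> with \<open>w\<close> in \<open>N\<close> this
    vector, if non-zero, is an eigenvector of \<open>L\<close> whose character is the inverse of
    \<open>comm _ w\<close>.\<close>
  define T where "T f = (\<Sum>j\<in>J. scl (f j) (A j v))" for f :: "'w \<Rightarrow> 'r"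
  define N where "N = {w. \<forall>m\<in>M. comm m w = 1}"
  have N_add: "w + w' \<in> N" if "w \<in> N" "w' \<in> N" for w w'
    using that by (simp add: N_def comm_add_right)
  have TV: "T f \<in> V" for f
    unfolding T_def using v A_in V_subspace by (auto intro!: subspace_sum subspace_scale)
  have T_orbit: "T f \<in> span (orbit v)" for f
    unfolding T_def by (intro span_sum span_scale span_base) (simp add: orbit_def)
  have A_coset: "A l v = A l' v" if "l \<in> L" "l - l' \<in> M" for l l'
  proof -
    have l': "l' \<in> L" using L_diff[OF that(1), of "l - l'"] that M_sub by auto
    have "A l' (A (l - l') v) = A l v"
      using v that l' M_sub by (subst A_mult) (auto simp: trivial_on_L)
    then show ?thesis using v(3)[OF that(2)] by simp
  qed
  have T_eigen: "scl (comm l w) (A l (T (\<lambda>j. comm j w))) = T (\<lambda>j. comm j w)"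
    if l: "l \<in> L" and w: "w \<in> N" for l w
  proof -
    have "A l (T (\<lambda>j. comm j w)) = (\<Sum>j\<in>J. scl (comm j w) (A l (A j v)))"
      unfolding T_def using v A_in V_subspace
      by (subst A_sum) (auto simp: A_scale subspace_scale)
    also have "\<dots> = (\<Sum>j\<in>J. scl (comm j w) (A (l + j) v))"
      using J l v by (intro sum.cong refl) (auto simp: A_mult trivial_on_L subset_iff)
    finally have "scl (comm l w) (A l (T (\<lambda>j. comm j w)))
        = (\<Sum>j\<in>J. scl (comm (l + j) w) (A (l + j) v))"
      by (simp add: scale_sum_right comm_add_left)
    \<comment> \<open>Adding \<open>l\<close> permutes \<open>L / M\<close>, and \<open>s\<close>
      brings each shifted representative back into \<open>J\<close>. Both factors of a summand
      depend only on the class, because \<open>w\<close> is in \<open>N\<close> and \<open>M\<close>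
      fixes \<open>v\<close>.\<close>
    also have "\<dots> = T (\<lambda>j. comm j w)"
      unfolding T_def
    proof (rule sum.reindex_bij_witness[where i = "\<lambda>j. s (j - l)" and j = "\<lambda>j. s (l + j)"])
      fix j assume j: "j \<in> J"
      then have jL: "j \<in> L" "l + j \<in> L" "j - l \<in> L" using J l by (auto intro: L_add L_diff)
      show "s (l + j) \<in> J" "s (j - l) \<in> J" using jL s_in by auto
      have m: "s (l + j) - (l + j) \<in> M"
        using Mdiff[OF M0 s(2)[OF jL(2)]] by simp
      have "s (s (l + j) - l) = s j"
        using m by (intro s_cong) (simp add: algebra_simps)
      then show "s (s (l + j) - l) = j" using s_idem[OF j] by simp
      have m': "s (j - l) - (j - l) \<in> M"
        using Mdiff[OF M0 s(2)[OF jL(3)]] by simp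
      have "s (l + s (j - l)) = s j"
        using m' by (intro s_cong) (simp add: algebra_simps)
      then show "s (l + s (j - l)) = j" using s_idem[OF j] by simp
      have "comm (s (l + j) - (l + j) + (l + j)) w = comm (l + j) w"
        using w m unfolding N_def by (subst comm_add_left) auto
      then have "comm (s (l + j)) w = comm (l + j) w" by simp
      moreover have "A (l + j) v = A (s (l + j)) v"
        using A_coset[OF jL(2) s(2)[OF jL(2)]] .
      ultimately show "scl (comm (s (l + j)) w) (A (s (l + j)) v) = scl (comm (l + j) w) (A (l + j) v)"
        by simp
    qed
    finally show ?thesis .
  qed
  have "\<exists>w\<in>N. T (\<lambda>j. comm j w) \<noteq> 0"
  proof (rule ccontr)
    assume "\<not> ?thesis"
    then have T0: "T (\<lambda>j. comm j w) = 0" if "w \<in> N" for w using that by blast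
    define K where "K = J - {s 0}"
    have s0: "s 0 \<in> M" using Mdiff[OF M0 s(2)[OF L_zero]] by simp
    have "g \<in> L - M" if "g \<in> K" for g
    proof -
      have g: "g \<in> J" "g \<noteq> s 0" using that by (auto simp: K_def)
      have "s g = s 0" if "g \<in> M" using that by (intro s_cong) simp
      then show ?thesis using g s_idem J by auto
    qed
    then have "\<forall>g\<in>K. \<exists>w. comm g w \<noteq> 1 \<and> w \<in> N"
      using M unfolding finite_level_def N_def by blast
    then obtain h where h: "\<And>g. g \<in> K \<Longrightarrow> comm g (h g) \<noteq> 1 \<and> h g \<in> N" by metis
    \<comment> \<open>Stated for all \<open>w\<close> in \<open>N\<close> because a new factor
      \<open>comm j (h g) - comm g (h g)\<close> splits the sum in two: one part has
      \<open>h g + w\<close> in place of \<open>w\<close>, the other is a multiple of the sum for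
      \<open>w\<close>.\<close>
    have prod0: "\<forall>w\<in>N. T (\<lambda>j. (\<Prod>g\<in>G. comm j (h g) - comm g (h g)) * comm j w) = 0"
      if "finite G" "G \<subseteq> K" for G
      using that
    proof (induction G rule: finite_induct)
      case (insert g G)
      have IH: "T (\<lambda>j. (\<Prod>g\<in>G. comm j (h g) - comm g (h g)) * comm j w) = 0" if "w \<in> N" for w
        using insert that by auto
      have "T (\<lambda>j. (\<Prod>g\<in>insert g G. comm j (h g) - comm g (h g)) * comm j w) =
         T (\<lambda>j. (\<Prod>g\<in>G. comm j (h g) - comm g (h g)) * comm j (h g + w)) -
         scl (comm g (h g)) (T (\<lambda>j. (\<Prod>g\<in>G. comm j (h g) - comm g (h g)) * comm j w))" for w
        using insert.hyps unfolding T_def scale_sum_right sum_subtractf [symmetric]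
        by (intro sum.cong refl)
          (simp add: comm_add_right left_diff_distrib scale_left_diff_distrib mult.assoc
            mult.left_commute)
      then show ?case using insert.prems h N_add by (simp add: IH)
    qed (simp add: T0)
    let ?P = "\<lambda>j. \<Prod>g\<in>K. comm j (h g) - comm g (h g)"
    have K: "finite K" using J by (simp add: K_def)
    have J_eq: "J = insert (s 0) K" "s 0 \<notin> K" using s_in[OF L_zero] by (auto simp: K_def)
    have "0 \<in> N" by (simp add: N_def)
    then have "T (\<lambda>j. ?P j * comm j 0) = 0" using prod0[OF K] by blast
    \<comment> \<open>Each \<open>j\<close> in \<open>K\<close> makes its own factor vanish, so only
      \<open>s 0\<close> survives. As \<open>s 0\<close> is in \<open>M\<close>, its factors are
      \<open>1 - comm g (h g)\<close>, all non-zero.\<close>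
    moreover have "T (\<lambda>j. ?P j * comm j 0) = scl (?P (s 0)) (A (s 0) v)"
    proof -
      have "(\<Sum>j\<in>K. scl (?P j * comm j 0) (A j v)) = 0"
      proof (intro sum.neutral ballI)
        fix j assume "j \<in> K"
        then have "?P j = 0" using K by (intro prod_zero) auto
        then show "scl (?P j * comm j 0) (A j v) = 0" by (simp only: mult_zero_left scale_zero_left)
      qed
      then show ?thesis unfolding T_def J_eq(1) using K J_eq(2) by simp
    qed
    moreover have "?P (s 0) \<noteq> 0"
      using K h s0 by (auto simp: N_def)
    ultimately show False using v s0 by simp
  qed
  then obtain w where w: "w \<in> N" "T (\<lambda>j. comm j w) \<noteq> 0" by blast
  \<comment> \<open>Applying \<open>A w\<close> multiplies the eigencharacter by
    \<open>comm _ w\<close>, which makes it trivial.\<close>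
  define u where "u = A w (T (\<lambda>j. comm j w))"
  have "A l u = u" if "l \<in> L" for l
  proof -
    have "A l u = A w (scl (comm l w) (A l (T (\<lambda>j. comm j w))))"
      unfolding u_def using TV A_in by (simp add: A_comm[of _ l w] A_scale)
    then show ?thesis using T_eigen[OF that w(1)] by (simp add: u_def)
  qed
  then have "fixed u" using TV A_in by (simp add: fixed_def u_def)
  moreover have "u \<noteq> 0" unfolding u_def by (rule A_nonzero[OF TV w(2)])
  moreover have "u \<in> span (orbit v)"
    using stable_span_orbit[OF v(1)] T_orbit by (simp add: u_def stable_def)
  ultimately show ?thesis by blast
qed

section \<open>Irreducibility and uniqueness for twisted representations\<close>

definition irreducible :: bool where
  "irreducible \<longleftrightarrow> V \<noteq> {0} \<and> (\<forall>U. stable U \<longrightarrow> U = {0} \<or> U = V)"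

definition smooth :: bool where
  "smooth \<longleftrightarrow> (\<forall>v\<in>V. \<exists>M. finite_level M \<and> (\<forall>m\<in>M. A m v = v))"

text \<open>\<open>exists_fixed\<close> places the fixed vector in the span of the orbit of
  \<open>v\<close>, and that span stays inside every stable subspace containing
  \<open>v\<close>.\<close>

lemma stable_has_fixed:
  assumes "smooth" "stable U" "U \<noteq> {0}"
  shows "\<exists>u\<in>U. fixed u \<and> u \<noteq> 0"
proof -
  obtain v where v: "v \<in> U" "v \<noteq> 0"
    using assms(2,3) subspace_0 by (auto simp: stable_def)
  then have "v \<in> V" using assms(2) by (auto simp: stable_def)
  then obtain M where "finite_level M" "\<And>m. m \<in> M \<Longrightarrow> A m v = v"
    using assms(1) unfolding smooth_def by blast
  then obtain u where "fixed u" "u \<noteq> 0" "u \<in> span (orbit v)"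
    using exists_fixed[of M v] v \<open>v \<in> V\<close> by blast
  then show ?thesis using span_orbit_subset[OF assms(2) v(1)] by blast
qed

lemma irreducible_span_orbit:
  assumes "smooth" "fixed v" "v \<noteq> 0" "V = span (orbit v)"
  shows "irreducible"
  unfolding irreducible_def
proof (intro conjI allI impI)
  show "V \<noteq> {0}" using assms(2,3) by (auto simp: fixed_def)
  fix U assume U: "stable U"
  show "U = {0} \<or> U = V"
  proof (cases "U = {0}")
    case False
    then obtain u where u: "u \<in> U" "fixed u" "u \<noteq> 0"
      using stable_has_fixed[OF assms(1) U] by blast
    have "U \<subseteq> V" using U by (simp add: stable_def)
    then have "u \<in> span (orbit v)" using u(1) assms(4) by blast
    then have "u \<in> span {v}" using fixed_in_span_orbit[OF assms(2)] u(2) by blast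
    then obtain k where k: "u = scl k v" by (auto simp: span_singleton)
    then have "v = scl (inverse k) u" using u(3) by auto
    then have "v \<in> U" using U u(1) by (auto simp: stable_def subspace_scale)
    then show ?thesis using span_orbit_subset[OF U] assms(4) \<open>U \<subseteq> V\<close> by blast
  qed simp
qed

end

text \<open>Goursat: the stable subspace of \<open>V1 \<times> V2\<close> generated by a pair of fixed vectors contains
  only one line of fixed vectors, hence meets neither factor and is the graph of an isomorphism.\<close>

lemma irreducible_twisted_reps_isomorphic:
  fixes scl1 :: "'r::field \<Rightarrow> 'u::ab_group_add \<Rightarrow> 'u" and scl2 :: "'r \<Rightarrow> 'v::ab_group_add \<Rightarrow> 'v"
  assumes R1: "twisted_rep \<kappa> L scl1 V1 A1" and R2: "twisted_rep \<kappa> L scl2 V2 A2"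
    and irr1: "twisted_rep.irreducible scl1 V1 A1"
    and irr2: "twisted_rep.irreducible scl2 V2 A2"
    and sm1: "twisted_rep.smooth \<kappa> L V1 A1" and sm2: "twisted_rep.smooth \<kappa> L V2 A2"
  shows "\<exists>f. bij_betw f V1 V2 \<and> (\<forall>x\<in>V1. \<forall>y\<in>V1. f (x + y) = f x + f y) \<and>
    (\<forall>c. \<forall>x\<in>V1. f (scl1 c x) = scl2 c (f x)) \<and> (\<forall>w. \<forall>x\<in>V1. f (A1 w x) = A2 w (f x))"
proof -
  interpret R1: twisted_rep \<kappa> L scl1 V1 A1 by (rule R1)
  interpret R2: twisted_rep \<kappa> L scl2 V2 A2 by (rule R2)
  define scl where "scl c z = (scl1 c (fst z), scl2 c (snd z))" for c and z :: "'u \<times> 'v"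
  define A where "A w z = (A1 w (fst z), A2 w (snd z))" for w and z :: "'u \<times> 'v"
  interpret P: vector_space scl
    by unfold_locales
      (simp_all add: scl_def R1.scale_right_distrib R2.scale_right_distrib
        R1.scale_left_distrib R2.scale_left_distrib)
  interpret P: twisted_rep \<kappa> L scl "V1 \<times> V2" A
  proof unfold_locales
    show "P.subspace (V1 \<times> V2)"
      using R1.V_subspace R2.V_subspace
      by (auto simp: P.subspace_def R1.subspace_def R2.subspace_def scl_def zero_prod_def)
  qed (auto simp: A_def scl_def R1.A_in R2.A_in R1.A_add R2.A_add R1.A_scale R2.A_scale
      R1.A_zero R2.A_zero R1.A_mult R2.A_mult)
  have ne: "V1 \<noteq> {0}" "V2 \<noteq> {0}"
    using irr1 irr2 by (auto simp: R1.irreducible_def R2.irreducible_def)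
  obtain v1 where v1: "R1.fixed v1" "v1 \<noteq> 0"
    using R1.stable_has_fixed[OF sm1 R1.stable_V ne(1)] by blast
  obtain v2 where v2: "R2.fixed v2" "v2 \<noteq> 0"
    using R2.stable_has_fixed[OF sm2 R2.stable_V ne(2)] by blast
  have v12: "P.fixed (v1, v2)"
    using v1 v2 by (auto simp: P.fixed_def R1.fixed_def R2.fixed_def A_def)
  define \<Gamma> where "\<Gamma> = P.span (P.orbit (v1, v2))"
  have stab: "P.stable \<Gamma>"
    unfolding \<Gamma>_def using v12 by (intro P.stable_span_orbit) (simp add: P.fixed_def)
  have vv: "(v1, v2) \<in> \<Gamma>"
    unfolding \<Gamma>_def using v12 by (intro P.orbit_base) (simp add: P.fixed_def)
  have sub: "\<Gamma> \<subseteq> V1 \<times> V2" and zero: "(0, 0) \<in> \<Gamma>"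
    and add: "\<And>z z'. z \<in> \<Gamma> \<Longrightarrow> z' \<in> \<Gamma> \<Longrightarrow> z + z' \<in> \<Gamma>"
    and diff: "\<And>z z'. z \<in> \<Gamma> \<Longrightarrow> z' \<in> \<Gamma> \<Longrightarrow> z - z' \<in> \<Gamma>"
    and scale: "\<And>c z. z \<in> \<Gamma> \<Longrightarrow> scl c z \<in> \<Gamma>"
    and act: "\<And>w z. z \<in> \<Gamma> \<Longrightarrow> A w z \<in> \<Gamma>"
    using stab P.subspace_0[of \<Gamma>] P.subspace_add[of \<Gamma>] P.subspace_diff[of \<Gamma>] P.subspace_scale[of \<Gamma>]
    by (auto simp: P.stable_def zero_prod_def)
  have line: "\<exists>c. z = scl c (v1, v2)" if "z \<in> \<Gamma>" "P.fixed z" for z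
    using P.fixed_in_span_orbit[OF v12 that(2)] that(1) unfolding \<Gamma>_def
    by (auto simp: P.span_singleton)
  have ker2: "y = 0" if "(0, y) \<in> \<Gamma>" for y
  proof -
    \<comment> \<open>The slice over 0 is stable, so it is 0 or \<open>V2\<close>. In the second
      case \<open>(0, v2)\<close> would be a fixed vector of \<Gamma> off the line through
      \<open>(v1, v2)\<close>.\<close>
    let ?U = "{y. (0, y) \<in> \<Gamma>}"
    have "R2.stable ?U"
      using sub zero add[of "(0, _)" "(0, _)"] scale[of "(0, _)"] act[of "(0, _)"]
      by (auto simp: R2.stable_def R2.subspace_def scl_def A_def R1.A_0)
    then have "?U = {0} \<or> ?U = V2" using irr2 by (auto simp: R2.irreducible_def)
    moreover have "?U \<noteq> V2"
    proof
      assume "?U = V2"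
      then have "(0, v2) \<in> \<Gamma>" using v2 by (auto simp: R2.fixed_def)
      moreover have "P.fixed (0, v2)"
        using v2 R1.subspace_0[OF R1.V_subspace] R1.A_0
        by (auto simp: P.fixed_def R2.fixed_def A_def)
      ultimately obtain c where "(0, v2) = scl c (v1, v2)" using line by blast
      then show False using v1 v2 by (auto simp: scl_def)
    qed
    ultimately show ?thesis using that by auto
  qed
  have ker1: "x = 0" if "(x, 0) \<in> \<Gamma>" for x
  proof -
    let ?U = "{x. (x, 0) \<in> \<Gamma>}"
    have "R1.stable ?U"
      using sub zero add[of "(_, 0)" "(_, 0)"] scale[of "(_, 0)"] act[of "(_, 0)"]
      by (auto simp: R1.stable_def R1.subspace_def scl_def A_def R2.A_0)
    then have "?U = {0} \<or> ?U = V1" using irr1 by (auto simp: R1.irreducible_def)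
    moreover have "?U \<noteq> V1"
    proof
      assume "?U = V1"
      then have "(v1, 0) \<in> \<Gamma>" using v1 by (auto simp: R1.fixed_def)
      moreover have "P.fixed (v1, 0)"
        using v1 R2.subspace_0[OF R2.V_subspace] R2.A_0
        by (auto simp: P.fixed_def R1.fixed_def A_def)
      ultimately obtain c where "(v1, 0) = scl c (v1, v2)" using line by blast
      then show False using v1 v2 by (auto simp: scl_def)
    qed
    ultimately show ?thesis using that by auto
  qed
  have dom: "fst ` \<Gamma> = V1"
  proof -
    have "R1.stable (fst ` \<Gamma>)"
      unfolding R1.stable_def R1.subspace_def
    proof (intro conjI ballI allI)
      show "fst ` \<Gamma> \<subseteq> V1" using sub by auto
      show "0 \<in> fst ` \<Gamma>" using zero by force
      show "x + y \<in> fst ` \<Gamma>" if "x \<in> fst ` \<Gamma>" "y \<in> fst ` \<Gamma>" for x y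
        using that add by (metis (no_types, lifting) fst_add image_iff)
      show "scl1 c x \<in> fst ` \<Gamma>" if "x \<in> fst ` \<Gamma>" for c x
        using that scale by (metis (no_types, lifting) fst_conv image_iff scl_def)
      show "A1 w x \<in> fst ` \<Gamma>" if "x \<in> fst ` \<Gamma>" for w x
        using that act by (metis (no_types, lifting) fst_conv image_iff A_def)
    qed
    moreover have "fst ` \<Gamma> \<noteq> {0}" using vv v1(2) by force
    ultimately show ?thesis using irr1 by (auto simp: R1.irreducible_def)
  qed
  have ran: "snd ` \<Gamma> = V2"
  proof -
    have "R2.stable (snd ` \<Gamma>)"
      unfolding R2.stable_def R2.subspace_def
    proof (intro conjI ballI allI)
      show "snd ` \<Gamma> \<subseteq> V2" using sub by auto
      show "0 \<in> snd ` \<Gamma>" using zero by force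
      show "x + y \<in> snd ` \<Gamma>" if "x \<in> snd ` \<Gamma>" "y \<in> snd ` \<Gamma>" for x y
        using that add by (metis (no_types, lifting) snd_add image_iff)
      show "scl2 c x \<in> snd ` \<Gamma>" if "x \<in> snd ` \<Gamma>" for c x
        using that scale by (metis (no_types, lifting) snd_conv image_iff scl_def)
      show "A2 w x \<in> snd ` \<Gamma>" if "x \<in> snd ` \<Gamma>" for w x
        using that act by (metis (no_types, lifting) snd_conv image_iff A_def)
    qed
    moreover have "snd ` \<Gamma> \<noteq> {0}" using vv v2(2) by force
    ultimately show ?thesis using irr2 by (auto simp: R2.irreducible_def)
  qed
  \<comment> \<open>By \<open>ker2\<close> the choice of \<open>f\<close> is forced: \<Gamma> is its
    graph, and linearity and equivariance of \<open>f\<close> are the closure properties of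
    \<Gamma>.\<close>
  have "\<forall>x\<in>V1. \<exists>y. (x, y) \<in> \<Gamma>" using dom by force
  then obtain f where f: "\<And>x. x \<in> V1 \<Longrightarrow> (x, f x) \<in> \<Gamma>" by metis
  have uniq: "f x = y" if "(x, y) \<in> \<Gamma>" for x y
  proof -
    have "x \<in> V1" using that sub by auto
    from diff[OF f[OF this] that] have "(0, f x - y) \<in> \<Gamma>" by simp
    then show ?thesis using ker2 by fastforce
  qed
  have "inj_on f V1"
  proof (rule inj_onI)
    fix x y assume "x \<in> V1" "y \<in> V1" "f x = f y"
    then have "(x - y, 0) \<in> \<Gamma>" using diff[OF f f, of x y] by simp
    then show "x = y" using ker1 by fastforce
  qed
  moreover have "f ` V1 = V2"
  proof -
    have "f x \<in> V2" if "x \<in> V1" for x using f[OF that] sub by auto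
    moreover have "y \<in> f ` V1" if y: "y \<in> V2" for y
    proof -
      obtain x where "(x, y) \<in> \<Gamma>" using y ran by force
      then show ?thesis using uniq sub by force
    qed
    ultimately show ?thesis by auto
  qed
  ultimately have "bij_betw f V1 V2" by (simp add: bij_betw_def)
  moreover have "f (x + y) = f x + f y" if "x \<in> V1" "y \<in> V1" for x y
    using add[OF f[OF that(1)] f[OF that(2)]] by (intro uniq) simp
  moreover have "f (scl1 c x) = scl2 c (f x)" if "x \<in> V1" for c x
    using scale[OF f[OF that], of c] by (intro uniq) (simp add: scl_def)
  moreover have "f (A1 w x) = A2 w (f x)" if "x \<in> V1" for w x
    using act[OF f[OF that], of w] by (intro uniq) (simp add: A_def)
  ultimately show ?thesis by blast
qed

section \<open>Symplectic bases\<close>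

lemma symplectic_formD:
  assumes "symplectic_form scaleW form"
  shows "form (w + w') z = form w z + form w' z" "form z (w + w') = form z w + form z w'"
    "form (scaleW c w) z = c * form w z" "form z (scaleW c w) = c * form z w"
    "form w w = 0" "(\<And>z. form w z = 0) \<Longrightarrow> w = 0"
  using assms unfolding symplectic_form_def
  unfolding Vector_Spaces.linear_iff by auto

locale symplectic = finite_dimensional_vector_space scaleW B
  for scaleW :: "'f::field \<Rightarrow> 'w::ab_group_add \<Rightarrow> 'w" and B :: "'w set" +
  fixes form :: "'w \<Rightarrow> 'w \<Rightarrow> 'f"
  assumes form: "symplectic_form scaleW form"
begin

lemma form_bilinear:
  "form (w + w') z = form w z + form w' z" "form z (w + w') = form z w + form z w'"
  "form (scaleW c w) z = c * form w z" "form z (scaleW c w) = c * form z w"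
  and form_self: "form w w = 0"
  and form_nondegenerate: "(\<And>z. form w z = 0) \<Longrightarrow> w = 0"
  using symplectic_formD[OF form] by metis+

lemma form_zero: "form 0 z = 0" "form z 0 = 0"
  using form_bilinear(3)[of 0 0 z] form_bilinear(4)[of z 0 0] by simp_all

lemma form_uminus: "form (- w) z = - form w z" "form z (- w) = - form z w"
  using form_bilinear(1)[of w "- w" z] form_bilinear(2)[of z w "- w"]
  by (simp_all add: form_zero eq_neg_iff_add_eq_0 add.commute)

lemma form_diff: "form (w - w') z = form w z - form w' z" "form z (w - w') = form z w - form z w'"
  using form_bilinear(1)[of w "- w'" z] form_bilinear(2)[of z w "- w'"] by (simp_all add: form_uminus)

lemma form_sum: "form (\<Sum>i\<in>I. g i) z = (\<Sum>i\<in>I. form (g i) z)"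
  "form z (\<Sum>i\<in>I. g i) = (\<Sum>i\<in>I. form z (g i))"
  by (induction I rule: infinite_finite_induct) (simp_all add: form_zero form_bilinear)

lemma form_commute: "form w z = - form z w"
proof -
  have "form (w + z) (w + z) = form w z + form z w"
    by (simp only: form_bilinear) (simp add: form_self)
  then have "form w z + form z w = 0" unfolding form_self by (rule sym)
  then show ?thesis by (simp add: eq_neg_iff_add_eq_0)
qed

definition hyperbolic :: "nat \<Rightarrow> (nat \<Rightarrow> 'w) \<Rightarrow> (nat \<Rightarrow> 'w) \<Rightarrow> bool" where
  "hyperbolic n e f \<longleftrightarrow> (\<forall>i<n. \<forall>j<n. form (e i) (e j) = 0 \<and> form (f i) (f j) = 0 \<and>
     form (e i) (f j) = (if i = j then 1 else 0))"

text \<open>Pairing a linear relation among the \<open>e i\<close> with \<open>f j\<close> isolates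
  its coefficient at \<open>e j\<close>. The bound guarantees that a hyperbolic family of maximal
  size exists.\<close>

lemma hyperbolic_bound:
  assumes "hyperbolic n e f" shows "n \<le> card B"
proof -
  have ef: "form (e i) (f j) = (if i = j then 1 else 0)" if "i < n" "j < n" for i j
    using assms that by (auto simp: hyperbolic_def)
  have inj: "inj_on e {..<n}"
  proof (rule inj_onI)
    fix i j assume "i \<in> {..<n}" "j \<in> {..<n}" "e i = e j"
    then show "i = j" using ef[of i j] ef[of j j] by (auto split: if_splits)
  qed
  have "independent (e ` {..<n})"
  proof
    assume "dependent (e ` {..<n})"
    then obtain u where u: "\<exists>x\<in>e ` {..<n}. u x \<noteq> 0" "(\<Sum>x\<in>e ` {..<n}. scaleW (u x) x) = 0"
      by (auto simp: dependent_finite)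
    then obtain j where j: "j < n" "u (e j) \<noteq> 0" by auto
    have "0 = form (\<Sum>x\<in>e ` {..<n}. scaleW (u x) x) (f j)" by (simp add: u form_zero)
    also have "\<dots> = (\<Sum>i<n. u (e i) * form (e i) (f j))"
      by (simp add: sum.reindex[OF inj] form_sum form_bilinear)
    also have "\<dots> = (\<Sum>i<n. if i = j then u (e i) else 0)"
      using j by (intro sum.cong) (auto simp: ef)
    also have "\<dots> = u (e j)" using j by simp
    finally show False using j by simp
  qed
  then have "card (e ` {..<n}) \<le> card B"
    using independent_span_bound[OF finite_Basis, of "e ` {..<n}"] span_Basis by auto
  then show ?thesis using inj by (simp add: card_image)
qed

text \<open>A hyperbolic family of maximal size spans: otherwise the orthogonal projection of some vector
  and a partner of it would extend the family.\<close>

lemma symplectic_basis: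
  "\<exists>n e f. hyperbolic n e f \<and>
    (\<forall>w. w = (\<Sum>i<n. scaleW (form w (f i)) (e i)) + (\<Sum>i<n. scaleW (form (e i) w) (f i)))"
proof -
  define P where "P m \<longleftrightarrow> (\<exists>e f. hyperbolic m e f)" for m
  have "P 0" by (simp add: P_def hyperbolic_def)
  moreover have bound: "\<forall>m. P m \<longrightarrow> m \<le> card B" using hyperbolic_bound by (auto simp: P_def)
  ultimately have n: "P (Greatest P)" and max: "\<And>m. P m \<Longrightarrow> m \<le> Greatest P"
    using GreatestI_nat[of P 0 "card B"] Greatest_le_nat[of P _ "card B"] by blast+
  define n where "n = Greatest P"
  obtain e f where h: "hyperbolic n e f" using n by (auto simp: P_def n_def)
  \<comment> \<open>The component of \<open>w\<close> orthogonal to all \<open>e i\<close> and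
    \<open>f i\<close>; the expansion to be proved says that it vanishes.\<close>
  define pr where "pr w = w - (\<Sum>i<n. scaleW (form w (f i)) (e i)) - (\<Sum>i<n. scaleW (form (e i) w) (f i))"
    for w
  have ee: "form (e i) (e j) = 0" and ff: "form (f i) (f j) = 0"
    and ef: "form (e i) (f j) = (if i = j then 1 else 0)" if "i < n" "j < n" for i j
    using h that by (simp_all add: hyperbolic_def)
  have delta: "(\<Sum>i<n. g i * (if i = j then c else 0)) = g j * c" if "j < n" for g j and c :: 'f
    using that by (simp add: if_distrib [of "(*) _"] cong: if_cong)
  have pr_e: "form (e j) (pr w) = 0" if "j < n" for j w
  proof -
    have "form (e j) (pr w) = form (e j) w - (\<Sum>i<n. form (e i) w * form (e j) (f i))"
      using that ee by (simp add: pr_def form_diff form_sum form_bilinear)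
    also have "(\<Sum>i<n. form (e i) w * form (e j) (f i)) =
        (\<Sum>i<n. form (e i) w * (if i = j then 1 else 0))"
      using that ef by (intro sum.cong) auto
    finally show ?thesis by (simp add: delta[OF that])
  qed
  have pr_f: "form (pr w) (f j) = 0" if "j < n" for j w
  proof -
    have "form (pr w) (f j) = form w (f j) - (\<Sum>i<n. form w (f i) * form (e i) (f j))"
      using that ff by (simp add: pr_def form_diff form_sum form_bilinear)
    also have "(\<Sum>i<n. form w (f i) * form (e i) (f j)) =
        (\<Sum>i<n. form w (f i) * (if i = j then 1 else 0))"
      using that ef by (intro sum.cong) auto
    finally show ?thesis by (simp add: delta[OF that])
  qed
  have pr0: "pr w = 0" for w
  proof (rule ccontr)
    assume "pr w \<noteq> 0"
    then obtain u where u: "form (pr w) u \<noteq> 0" using form_nondegenerate by blast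
    have fp: "form (f j) (pr w) = 0" "form (pr w) (e j) = 0" if "j < n" for j
      using pr_e[OF that, of w] pr_f[OF that, of w] form_commute[of "f j" "pr w"]
        form_commute[of "pr w" "e j"] by simp_all
    \<comment> \<open>\<open>pr w\<close> is orthogonal to the family, so replacing \<open>u\<close>
      by \<open>pr u\<close> keeps its pairing with \<open>pr w\<close>. After normalization,
      \<open>pr w\<close> and \<open>y\<close> form a hyperbolic pair orthogonal to the old
      ones.\<close>
    have "form (pr w) (pr u) = form (pr w) u"
      by (subst (2) pr_def) (simp add: form_diff form_sum form_bilinear fp pr_f)
    define y where "y = scaleW (inverse (form (pr w) u)) (pr u)"
    have y: "form (pr w) y = 1" "\<And>j. j < n \<Longrightarrow> form (e j) y = 0" "\<And>j. j < n \<Longrightarrow> form y (f j) = 0"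
      using u \<open>form (pr w) (pr u) = form (pr w) u\<close>
      by (simp_all add: y_def form_bilinear pr_e pr_f)
    have y': "form (f j) y = 0" if "j < n" for j
      using y(3)[OF that] form_commute[of "f j" y] by simp
    have "form ((e(n := pr w)) i) ((e(n := pr w)) j) = 0 \<and> form ((f(n := y)) i) ((f(n := y)) j) = 0 \<and>
        form ((e(n := pr w)) i) ((f(n := y)) j) = (if i = j then 1 else 0)"
      if ij: "i < Suc n" "j < Suc n" for i j
    proof -
      consider "i < n" "j < n" | "i < n" "j = n" | "i = n" "j < n" | "i = n" "j = n"
        using ij by linarith
      then show ?thesis
        by cases (simp_all add: ee ff ef y y' pr_e pr_f fp form_self)
    qed
    then have "hyperbolic (Suc n) (e(n := pr w)) (f(n := y))"
      unfolding hyperbolic_def by blast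
    then have "Suc n \<le> n" using max[of "Suc n"] unfolding P_def n_def by blast
    then show False by simp
  qed
  show ?thesis
  proof (intro exI conjI allI)
    show "hyperbolic n e f" by (rule h)
    fix w
    show "w = (\<Sum>i<n. scaleW (form w (f i)) (e i)) + (\<Sum>i<n. scaleW (form (e i) w) (f i))"
      using pr0[of w] by (simp add: pr_def algebra_simps)
  qed
qed

end

section \<open>Self-dual lattices in the base field\<close>

definition add_subgroup :: "'a::ab_group_add set \<Rightarrow> bool" where
  "add_subgroup S \<longleftrightarrow> 0 \<in> S \<and> (\<forall>x\<in>S. \<forall>y\<in>S. x - y \<in> S)"

lemma add_subgroupD:
  assumes "add_subgroup S"
  shows "0 \<in> S" "x \<in> S \<Longrightarrow> y \<in> S \<Longrightarrow> x - y \<in> S" "x \<in> S \<Longrightarrow> - x \<in> S"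
    "x \<in> S \<Longrightarrow> y \<in> S \<Longrightarrow> x + y \<in> S"
proof -
  show 0: "0 \<in> S" using assms by (simp add: add_subgroup_def)
  show d: "x - y \<in> S" if "x \<in> S" "y \<in> S" for x y
    using assms that by (simp add: add_subgroup_def)
  show u: "- x \<in> S" if "x \<in> S" for x using d[OF 0 that] that by simp
  show "x + y \<in> S" if "x \<in> S" "y \<in> S" using d[OF that(1) u[OF that(2)]] by simp
qed

lemma add_subgroup_sum:
  "add_subgroup S \<Longrightarrow> (\<And>i. i \<in> I \<Longrightarrow> f i \<in> S) \<Longrightarrow> (\<Sum>i\<in>I. f i) \<in> S"
  by (induction I rule: infinite_finite_induct) (auto simp: add_subgroupD)

definition finite_index :: "'a::ab_group_add set \<Rightarrow> 'a set \<Rightarrow> bool" where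
  "finite_index D M \<longleftrightarrow> (\<exists>I. finite I \<and> I \<subseteq> D \<and> (\<forall>d\<in>D. \<exists>i\<in>I. d - i \<in> M))"

text \<open>Representatives for \<open>D\<close> may lie outside \<open>E\<close>; each is replaced
  by an element of \<open>E\<close> in the same class modulo \<open>M\<close>, if there is
  one.\<close>

lemma finite_index_subset:
  assumes "finite_index D M" "add_subgroup M" "E \<subseteq> D"
  shows "finite_index E M"
proof -
  obtain I where I: "finite I" "\<And>d. d \<in> D \<Longrightarrow> \<exists>i\<in>I. d - i \<in> M"
    using assms(1) unfolding finite_index_def by blast
  define I' where "I' = {i \<in> I. \<exists>e\<in>E. e - i \<in> M}"
  have "\<forall>i\<in>I'. \<exists>e. e \<in> E \<and> e - i \<in> M" by (auto simp: I'_def)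
  then obtain g where g: "\<And>i. i \<in> I' \<Longrightarrow> g i \<in> E \<and> g i - i \<in> M" by metis
  have "\<exists>j\<in>g ` I'. e - j \<in> M" if e: "e \<in> E" for e
  proof -
    obtain i where i: "i \<in> I" "e - i \<in> M" using I(2) e assms(3) by blast
    then have "i \<in> I'" using e by (auto simp: I'_def)
    moreover from this have "(e - i) - (g i - i) \<in> M"
      using g i by (blast intro: add_subgroupD(2)[OF assms(2)])
    ultimately show ?thesis by auto
  qed
  moreover have "finite (g ` I')" "g ` I' \<subseteq> E" using I(1) g by (auto simp: I'_def)
  ultimately show ?thesis unfolding finite_index_def by blast
qed

lemma finite_index_mono:
  assumes "finite_index D M" "M \<subseteq> M'"
  shows "finite_index D M'"
proof -
  obtain I where "finite I" "I \<subseteq> D" "\<And>d. d \<in> D \<Longrightarrow> \<exists>i\<in>I. d - i \<in> M"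
    using assms(1) unfolding finite_index_def by blast
  then show ?thesis unfolding finite_index_def using assms(2) by (intro exI[of _ I]) (metis subsetD)
qed

text \<open>The topological properties shared by discrete finite fields and non-archimedean fields;
  \<open>small_subgroup\<close> is what excludes the archimedean ones.\<close>

locale linear_topology =
  fixes T :: "'f::field topology"
  assumes topspace: "topspace T = UNIV"
    and translate: "openin T U \<Longrightarrow> openin T ((+) a ` U)"
    and small_subgroup: "openin T U \<Longrightarrow> 0 \<in> U \<Longrightarrow> \<exists>N. openin T N \<and> add_subgroup N \<and> N \<subseteq> U"
    and scaling: "openin T U \<Longrightarrow> 0 \<in> U \<Longrightarrow> \<exists>N. openin T N \<and> 0 \<in> N \<and> (\<forall>x\<in>N. c * x \<in> U)"

text \<open>\<open>D\<close> and \<open>E\<close> will be the coordinate ranges of a self-dual lattice of the symplectic space.\<close>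

locale dual_lattices = linear_topology T
  for T :: "'f::field topology" +
  fixes \<psi> :: "'f \<Rightarrow> 'r::field" and D E :: "'f set"
  assumes psi_nonzero: "\<psi> x \<noteq> 0" and psi_add: "\<psi> (x + y) = \<psi> x * \<psi> y"
    and psi_locally_trivial: "\<exists>U. openin T U \<and> 0 \<in> U \<and> (\<forall>y\<in>U. \<psi> y = 1)"
    and D_subgroup: "add_subgroup D" and E_subgroup: "add_subgroup E"
    and D_open: "\<exists>U. openin T U \<and> 0 \<in> U \<and> U \<subseteq> D" and E_open: "\<exists>U. openin T U \<and> 0 \<in> U \<and> U \<subseteq> E"
    and pairing: "x \<in> D \<Longrightarrow> y \<in> E \<Longrightarrow> \<psi> (x * y) = 1"
    and dual_E: "(\<And>y. y \<in> E \<Longrightarrow> \<psi> (x * y) = 1) \<Longrightarrow> x \<in> D"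
    and dual_D: "(\<And>x. x \<in> D \<Longrightarrow> \<psi> (x * y) = 1) \<Longrightarrow> y \<in> E"
    and sublattices: "openin T U \<Longrightarrow> 0 \<in> U \<Longrightarrow> \<exists>D' E'.
      add_subgroup D' \<and> D' \<subseteq> D \<inter> U \<and> finite_index D D' \<and>
      (\<forall>x\<in>D - D'. \<exists>y. \<psi> (x * y) \<noteq> 1 \<and> (\<forall>z\<in>D'. \<psi> (z * y) = 1)) \<and>
      add_subgroup E' \<and> E' \<subseteq> E \<inter> U \<and> finite_index E E' \<and>
      (\<forall>x\<in>E - E'. \<exists>y. \<psi> (x * y) \<noteq> 1 \<and> (\<forall>z\<in>E'. \<psi> (z * y) = 1))"

text \<open>In the discrete topology \<open>{0}\<close> is open, and \<open>UNIV\<close> and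
  \<open>{0}\<close> annihilate each other: for non-zero \<open>x\<close> the element
  \<open>t / x\<close> pairs with \<open>x\<close> to \<open>t\<close>. The resulting lattice in
  \<open>W\<close> is the Lagrangian spanned by the \<open>e i\<close>.\<close>

lemma dual_lattices_finite:
  fixes \<psi> :: "'f::field \<Rightarrow> 'r::field"
  assumes "finite (UNIV :: 'f set)" "T = discrete_topology UNIV" "smooth_character T \<psi>" "\<psi> t \<noteq> 1"
  shows "dual_lattices T \<psi> UNIV {0}"
proof -
  have mult: "\<And>x y. \<psi> (x + y) = \<psi> x * \<psi> y" and nz: "\<And>x. \<psi> x \<noteq> 0"
    using assms(3) by (auto simp: smooth_character_def)
  have psi0: "\<psi> 0 = 1" using mult[of 0 0] nz[of 0] by simp
  have sep: "\<exists>y. \<psi> (x * y) \<noteq> 1" "\<exists>y. \<psi> (y * x) \<noteq> 1" if "x \<noteq> 0" for x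
    using that assms(4) by (auto intro: exI[of _ "t / x"])
  have fin: "finite_index UNIV ({0} :: 'f set)" "finite_index {0} ({0} :: 'f set)"
    using assms(1) by (auto simp: finite_index_def intro: exI[of _ UNIV] exI[of _ "{0}"])
  have one: "add_subgroup ({0} :: 'f set)" "add_subgroup (UNIV :: 'f set)"
    by (simp_all add: add_subgroup_def)
  show ?thesis
  proof (intro dual_lattices.intro dual_lattices_axioms.intro linear_topology.intro)
    fix U :: "'f set" and c :: 'f assume U: "0 \<in> U"
    show "\<exists>N. openin T N \<and> add_subgroup N \<and> N \<subseteq> U"
      using U one by (intro exI[of _ "{0}"]) (simp add: assms(2))
    show "\<exists>N. openin T N \<and> 0 \<in> N \<and> (\<forall>x\<in>N. c * x \<in> U)"
      using U by (intro exI[of _ "{0}"]) (simp add: assms(2))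
    show "\<exists>D' E'. add_subgroup D' \<and> D' \<subseteq> UNIV \<inter> U \<and> finite_index UNIV D' \<and>
      (\<forall>x\<in>UNIV - D'. \<exists>y. \<psi> (x * y) \<noteq> 1 \<and> (\<forall>z\<in>D'. \<psi> (z * y) = 1)) \<and>
      add_subgroup E' \<and> E' \<subseteq> {0} \<inter> U \<and> finite_index {0} E' \<and>
      (\<forall>x\<in>{0} - E'. \<exists>y. \<psi> (x * y) \<noteq> 1 \<and> (\<forall>z\<in>E'. \<psi> (z * y) = 1))"
      using U fin sep one by (intro exI[of _ "{0}"]) (simp add: psi0)
  next
    show "\<exists>U. openin T U \<and> 0 \<in> U \<and> (\<forall>y\<in>U. \<psi> y = 1)" "\<exists>U. openin T U \<and> 0 \<in> U \<and> U \<subseteq> {0}"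
      by (intro exI[of _ "{0}"], simp add: assms(2) psi0)+
    show "\<exists>U. openin T U \<and> 0 \<in> U \<and> U \<subseteq> UNIV" by (intro exI[of _ UNIV]) (simp add: assms(2))
    show "\<psi> (x * y) = 1" if "y \<in> {0}" for x y using that by (simp add: psi0)
    show "y \<in> {0}" if "\<And>x. x \<in> UNIV \<Longrightarrow> \<psi> (x * y) = 1" for y
      using that sep(2)[of y] by auto
  qed (simp_all add: assms(2) mult nz one)
qed

section \<open>Dual lattices in a non-archimedean local field\<close>

locale nonarch =
  fixes v :: "'f::field \<Rightarrow> real"
  assumes nonarch: "nonarch_abs v"
begin

lemma v_nonneg: "0 \<le> v x" and v_eq_0: "v x = 0 \<longleftrightarrow> x = 0" and v_mult: "v (x * y) = v x * v y"
  and v_add: "v (x + y) \<le> max (v x) (v y)"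
  using nonarch by (auto simp: nonarch_abs_def)

lemma v_pos: "x \<noteq> 0 \<Longrightarrow> 0 < v x"
  using v_nonneg[of x] v_eq_0[of x] by linarith

lemma v_1: "v 1 = 1"
  using v_mult[of 1 1] v_eq_0[of 1] by simp

lemma v_0: "v 0 = 0"
  by (simp add: v_eq_0)

lemma v_uminus: "v (- x) = v x"
proof -
  have "v (- 1) * v (- 1) = 1" using v_mult[of "- 1" "- 1"] v_1 by simp
  then have "v (- 1) = 1" using v_nonneg[of "- 1"] by (simp add: square_eq_1_iff)
  then show ?thesis using v_mult[of "- 1" x] by simp
qed

lemma v_diff: "v (x - y) \<le> max (v x) (v y)"
  using v_add[of x "- y"] by (simp add: v_uminus)

lemma v_commute: "v (x - y) = v (y - x)"
  using v_uminus[of "x - y"] by simp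

lemma v_divide: "y \<noteq> 0 \<Longrightarrow> v (x / y) = v x / v y"
  using v_mult[of "x / y" y] v_eq_0[of y] by (simp add: field_simps)

lemma v_power: "v (x ^ n) = v x ^ n"
  by (induction n) (simp_all add: v_1 v_mult)

lemma openin_abs_topology:
  "openin (abs_topology v) U \<longleftrightarrow> (\<forall>x\<in>U. \<exists>r>0. \<forall>y. v (x - y) < r \<longrightarrow> y \<in> U)"
proof -
  interpret M: Metric_space UNIV "abs_dist v"
  proof
    fix x y z :: 'f
    show "abs_dist v x z \<le> abs_dist v x y + abs_dist v y z"
      using v_add[of "x - y" "y - z"] v_nonneg[of "x - y"] v_nonneg[of "y - z"]
      by (simp add: abs_dist_def)
  qed (simp_all add: abs_dist_def v_nonneg v_eq_0 v_commute)
  show ?thesis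
    unfolding abs_topology_def M.openin_mtopology by (auto simp: M.mball_def abs_dist_def subset_iff)
qed

lemma open_ball: "0 < r \<Longrightarrow> openin (abs_topology v) {x. v x < r}"
  unfolding openin_abs_topology
proof (intro ballI exI[of _ r] conjI allI impI)
  fix x y assume "x \<in> {x. v x < r}" "v (x - y) < r"
  then show "y \<in> {x. v x < r}" using v_diff[of x "x - y"] by auto
qed

lemma ball_in_open:
  assumes "openin (abs_topology v) U" "0 \<in> U"
  shows "\<exists>r>0. \<forall>y. v y < r \<longrightarrow> y \<in> U"
proof -
  from assms obtain r where r: "0 < r" "\<And>y. v (0 - y) < r \<Longrightarrow> y \<in> U"
    unfolding openin_abs_topology by blast
  then show ?thesis by (intro exI[of _ r]) (simp add: v_uminus)
qed

lemma subgroup_ball: "0 < r \<Longrightarrow> add_subgroup {x. v x < r}"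
  and subgroup_cball: "0 \<le> r \<Longrightarrow> add_subgroup {x. v x \<le> r}"
proof -
  show "add_subgroup {x. v x < r}" if "0 < r"
    unfolding add_subgroup_def
  proof (intro conjI ballI)
    fix x y assume "x \<in> {x. v x < r}" "y \<in> {x. v x < r}"
    then show "x - y \<in> {x. v x < r}" using v_diff[of x y] by auto
  qed (simp add: v_0 that)
  show "add_subgroup {x. v x \<le> r}" if "0 \<le> r"
    unfolding add_subgroup_def
  proof (intro conjI ballI)
    fix x y assume "x \<in> {x. v x \<le> r}" "y \<in> {x. v x \<le> r}"
    then show "x - y \<in> {x. v x \<le> r}" using v_diff[of x y] by auto
  qed (simp add: v_0 that)
qed

lemma linear_topology_abs: "linear_topology (abs_topology v)"
proof
  show "topspace (abs_topology v) = UNIV"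
  proof -
    have "openin (abs_topology v) UNIV"
      unfolding openin_abs_topology using zero_less_one by blast
    then show ?thesis by (simp add: openin_subset top.extremum_uniqueI)
  qed
next
  fix U a assume U: "openin (abs_topology v) U"
  show "openin (abs_topology v) ((+) a ` U)"
    unfolding openin_abs_topology
  proof safe
    fix x assume "x \<in> U"
    then obtain r where "r > 0" and r: "\<And>y. v (x - y) < r \<Longrightarrow> y \<in> U"
      using U unfolding openin_abs_topology by blast
    have "y \<in> (+) a ` U" if "v (a + x - y) < r" for y
      using r[of "y - a"] that by (force simp: algebra_simps)
    then show "\<exists>r>0. \<forall>y. v (a + x - y) < r \<longrightarrow> y \<in> (+) a ` U" using \<open>r > 0\<close> by blast
  qed
next
  fix U :: "'f set" assume "openin (abs_topology v) U" "0 \<in> U"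
  then obtain r where "0 < r" "\<And>y. v y < r \<Longrightarrow> y \<in> U"
    using ball_in_open by blast
  then show "\<exists>N. openin (abs_topology v) N \<and> add_subgroup N \<and> N \<subseteq> U"
    using open_ball subgroup_ball by (intro exI[of _ "{x. v x < r}"]) auto
next
  fix U :: "'f set" and c assume "openin (abs_topology v) U" "0 \<in> U"
  then obtain r where r: "0 < r" "\<And>y. v y < r \<Longrightarrow> y \<in> U"
    using ball_in_open by blast
  \<comment> \<open>The summand 1 covers the case \<open>c = 0\<close>.\<close>
  have pos: "0 < r / (v c + 1)" using r v_nonneg[of c] by simp
  have "c * x \<in> U" if "v x < r / (v c + 1)" for x
  proof (rule r)
    have "v x * (v c + 1) < r" using that v_nonneg[of c] by (simp add: field_simps)
    then show "v (c * x) < r" using v_nonneg[of x] by (simp add: v_mult algebra_simps)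
  qed
  then show "\<exists>N. openin (abs_topology v) N \<and> 0 \<in> N \<and> (\<forall>x\<in>N. c * x \<in> U)"
    using open_ball[OF pos] pos by (intro exI[of _ "{x. v x < r / (v c + 1)}"]) (auto simp: v_0)
qed

lemma finite_residue_field:
  assumes "finite (carrier (residue_field v))"
  shows "finite_index {x. v x \<le> 1} {x. v x < 1}"
proof -
  define \<phi> where "\<phi> a = {h + a |h. v h < 1}" for a
  have "carrier (residue_field v) = \<phi> ` {x. v x \<le> 1}"
    unfolding residue_field_def FactRing_def A_RCOSETS_def RCOSETS_def r_coset_def valuation_ring_def \<phi>_def
    by auto
  then have "finite (\<phi> ` {x. v x \<le> 1})" using assms by simp
  then obtain I where I: "I \<subseteq> {x. v x \<le> 1}" "finite I" "\<phi> ` {x. v x \<le> 1} = \<phi> ` I"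
    using finite_subset_image[of "\<phi> ` {x. v x \<le> 1}" \<phi> "{x. v x \<le> 1}"] by auto
  have "\<exists>i\<in>I. d - i \<in> {x. v x < 1}" if "v d \<le> 1" for d
  proof -
    have "\<phi> d \<in> \<phi> ` I" unfolding I(3) [symmetric] by (rule imageI) (simp add: \<open>v d \<le> 1\<close>)
    then obtain i where i: "i \<in> I" "\<phi> d = \<phi> i" by blast
    have "d = 0 + d" "v 0 < 1" by (simp_all add: v_0)
    then have "d \<in> \<phi> d" unfolding \<phi>_def by blast
    then have "d \<in> \<phi> i" using i(2) by simp
    then obtain h where "d = h + i" "v h < 1" unfolding \<phi>_def by blast
    then show ?thesis using i(1) by (intro bexI[of _ i]) simp_all
  qed
  then show ?thesis unfolding finite_index_def using I(1,2) by blast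
qed

text \<open>Digit expansions in the uniformizer \<open>u\<close>: finitely many residue
  representatives give finitely many expansions of length \<open>n\<close>, which represent the unit
  ball modulo \<open>u ^ n\<close>. Multiplication by \<open>b\<close> rescales the unit ball to the
  ball of radius \<open>v b\<close>.\<close>

lemma finite_index_cball:
  assumes u: "0 < v u" "v u < 1" "\<And>x. x \<noteq> 0 \<Longrightarrow> \<exists>n::int. v x = v u powi n"
    and fin: "finite_index {x. v x \<le> 1} {x. v x < 1}" and ab: "a \<noteq> 0" "b \<noteq> 0"
  shows "finite_index {x. v x \<le> v b} {x. v x \<le> v a}"
proof -
  have u0: "u \<noteq> 0" using u(1) v_0 by auto
  \<comment> \<open>Discreteness of the valuation: no value lies strictly between \<open>v u\<close>
    and 1.\<close>
  have gen: "v x \<le> v u" if "v x < 1" for x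
  proof (cases "x = 0")
    case False
    then obtain n :: int where n: "v x = v u powi n" using u(3) by blast
    have "0 < n"
    proof (rule ccontr)
      assume "\<not> 0 < n"
      then have "v u powi 0 \<le> v u powi n" using u(1,2) by (intro power_int_decreasing) auto
      then show False using \<open>v x < 1\<close> n by simp
    qed
    then have "v u powi n \<le> v u powi 1" using u(1,2) by (intro power_int_decreasing) auto
    then show ?thesis using n by simp
  qed (use u(1) v_0 in simp)
  obtain I where I: "finite I" "I \<subseteq> {x. v x \<le> 1}" "\<And>d. v d \<le> 1 \<Longrightarrow> \<exists>i\<in>I. v (d - i) < 1"
    using fin unfolding finite_index_def Ball_def mem_Collect_eq by (elim exE conjE) simp
  have step: "\<exists>K. finite K \<and> K \<subseteq> {x. v x \<le> 1} \<and> (\<forall>d. v d \<le> 1 \<longrightarrow> (\<exists>i\<in>K. v (d - i) \<le> v u ^ n))" for n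
  proof (induction n)
    case 0
    have "v (d - 0) \<le> v u ^ 0" if "v d \<le> 1" for d using that by simp
    then show ?case by (intro exI[of _ "{0}"]) (simp add: v_0)
  next
    case (Suc n)
    then obtain K where K: "finite K" "K \<subseteq> {x. v x \<le> 1}"
      "\<And>d. v d \<le> 1 \<Longrightarrow> \<exists>i\<in>K. v (d - i) \<le> v u ^ n" by blast
    \<comment> \<open>The leading digit is \<open>i\<close>; the remaining digits \<open>k\<close>
      are those of \<open>(d - i) / u\<close>, which is integral by \<open>gen\<close>.\<close>
    let ?K = "(\<lambda>(i, k). i + u * k) ` (I \<times> K)"
    have "\<exists>k\<in>?K. v (d - k) \<le> v u ^ Suc n" if d: "v d \<le> 1" for d
    proof -
      obtain i where i: "i \<in> I" "v (d - i) < 1" using I(3)[OF d] by blast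
      then have "v ((d - i) / u) \<le> 1" using gen[OF i(2)] u(1) u0 by (simp add: v_divide)
      then obtain k where k: "k \<in> K" "v ((d - i) / u - k) \<le> v u ^ n" using K(3) by blast
      have "d - (i + u * k) = u * ((d - i) / u - k)" using u0 by (simp add: field_simps)
      then have "v (d - (i + u * k)) \<le> v u ^ Suc n" using k(2) u(1) by (simp add: v_mult)
      then show ?thesis using i(1) k(1) by force
    qed
    moreover have "?K \<subseteq> {x. v x \<le> 1}"
    proof
      fix z assume "z \<in> ?K"
      then obtain i k where z: "z = i + u * k" "i \<in> I" "k \<in> K" by auto
      have "v u * v k \<le> 1 * 1" using z K(2) u v_nonneg[of k] by (intro mult_mono) auto
      moreover have "v i \<le> 1" using z I(2) by auto
      ultimately show "z \<in> {x. v x \<le> 1}" using v_add[of i "u * k"] z(1) by (simp add: v_mult)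
    qed
    moreover have "finite ?K" using I(1) K(1) by simp
    ultimately show ?case by blast
  qed
  have pos: "0 < v a" "0 < v b" using ab by (simp_all add: v_pos)
  then obtain n where n: "v u ^ n < v a / v b" using real_arch_pow_inv[of "v a / v b" "v u"] u(2) by auto
  obtain K where K: "finite K" "K \<subseteq> {x. v x \<le> 1}"
    "\<And>d. v d \<le> 1 \<Longrightarrow> \<exists>i\<in>K. v (d - i) \<le> v u ^ n"
    using step[of n] by (elim exE conjE) simp
  have "\<exists>i\<in>(*) b ` K. d - i \<in> {x. v x \<le> v a}" if d: "v d \<le> v b" for d
  proof -
    have "v (d / b) \<le> 1" using d ab pos by (simp add: v_divide)
    then obtain i where i: "i \<in> K" "v (d / b - i) \<le> v u ^ n" using K(3) by blast
    have "d - b * i = b * (d / b - i)" using ab by (simp add: field_simps)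
    then have "v (d - b * i) = v b * v (d / b - i)" by (simp add: v_mult)
    also have "\<dots> \<le> v b * (v a / v b)" using i(2) n pos by (intro mult_left_mono) auto
    finally show ?thesis using i(1) pos by auto
  qed
  moreover have "(*) b ` K \<subseteq> {x. v x \<le> v b}"
    using K(2) pos by (auto simp: v_mult mult_le_cancel_left1)
  ultimately show ?thesis unfolding finite_index_def using K(1)
    by (intro exI[of _ "(*) b ` K"]) simp
qed

text \<open>\<open>E\<close> is the annihilator of the valuation ring; it depends on the conductor
  of \<open>\<psi>\<close> and need not equal \<open>D\<close>. It is a fractional ideal: stable
  under \<open>D\<close>, containing a ball because \<open>\<psi>\<close> is trivial near 0, and
  bounded because \<open>t\<close> is not in it.\<close>

lemma dual_lattices_local:
  fixes \<psi> :: "'f \<Rightarrow> 'r::field"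
  assumes local: "nonarch_local_field v" and T: "T = abs_topology v"
    and psi: "smooth_character T \<psi>" "\<psi> t \<noteq> 1"
  shows "dual_lattices T \<psi> {x. v x \<le> 1} {y. \<forall>x. v x \<le> 1 \<longrightarrow> \<psi> (x * y) = 1}"
    (is "dual_lattices T \<psi> ?D ?E")
proof -
  obtain u where u: "0 < v u" "v u < 1" "\<And>x. x \<noteq> 0 \<Longrightarrow> \<exists>n::int. v x = v u powi n"
    using local unfolding nonarch_local_field_def by blast
  have fin: "finite_index {x. v x \<le> 1} {x. v x < 1}"
    using local by (intro finite_residue_field) (simp add: nonarch_local_field_def)
  have mult: "\<And>x y. \<psi> (x + y) = \<psi> x * \<psi> y" and nz: "\<And>x. \<psi> x \<noteq> 0"
    and cont: "\<And>x. \<exists>U. openin T U \<and> x \<in> U \<and> (\<forall>y\<in>U. \<psi> y = \<psi> x)"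
    using psi(1) by (auto simp: smooth_character_def)
  have psi0: "\<psi> 0 = 1" using mult[of 0 0] nz[of 0] by simp
  have psi_diff: "\<psi> (x - y) = \<psi> x / \<psi> y" for x y using mult[of "x - y" y] nz[of y] by simp
  obtain U where U: "openin T U" "0 \<in> U" "\<And>y. y \<in> U \<Longrightarrow> \<psi> y = 1" using cont[of 0] psi0 by auto
  then obtain r where r: "0 < r" "\<And>y. v y < r \<Longrightarrow> \<psi> y = 1"
    using ball_in_open[of U] unfolding T by blast
  have E_ball: "y \<in> ?E" if "v y < r" for y
  proof -
    have "v (x * y) < r" if "v x \<le> 1" for x
      using mult_right_mono[OF that v_nonneg[of y]] \<open>v y < r\<close> by (simp add: v_mult)
    then show ?thesis using r(2) by simp
  qed
  have E_module: "z \<in> ?E" if y: "y \<in> ?E" "v z \<le> v y" for y z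
  proof (cases "y = 0")
    case True
    then show ?thesis using y v_nonneg[of z] v_eq_0[of z] v_0 by simp
  next
    case False
    have "\<psi> (x * z) = 1" if "v x \<le> 1" for x
    proof -
      have "v (z / y) \<le> 1" using False y(2) v_nonneg[of y] v_eq_0[of y] by (simp add: v_divide)
      then have "v (x * (z / y)) \<le> 1"
        using that v_nonneg[of x] v_nonneg[of "z / y"] mult_mono[of "v x" 1 "v (z / y)" 1]
        unfolding v_mult by simp
      then have "\<psi> (x * (z / y) * y) = 1" using y(1) by blast
      then show ?thesis using False by simp
    qed
    then show ?thesis by simp
  qed
  have tE: "t \<notin> ?E"
  proof
    assume "t \<in> ?E"
    then have "v 1 \<le> 1 \<longrightarrow> \<psi> (1 * t) = 1" by blast
    then show False using psi(2) v_1 by simp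
  qed
  have E_bound: "v e < v t" if "e \<in> ?E" for e
    using E_module[OF that, of t] tE by (meson not_le_imp_less)
  have t0: "t \<noteq> 0" using psi(2) psi0 by auto
  have small: "\<exists>k. v (u ^ k) < s" if "0 < s" for s
    using real_arch_pow_inv[OF that u(2)] by (simp add: v_power)
  have u0: "u ^ k \<noteq> 0" for k using u(1) v_0 by auto
  have D_sub: "add_subgroup ?D" by (rule subgroup_cball) simp
  have E_sub: "add_subgroup ?E"
    by (auto simp: add_subgroup_def psi0 right_diff_distrib psi_diff)
  \<comment> \<open>As \<open>E\<close> is stable under \<open>D\<close>, multiplication by an
    \<open>x\<close> that annihilates \<open>E\<close> maps \<open>E\<close> into itself. If
    \<open>1 < v x\<close>, powers of \<open>x\<close> would carry the non-zero element
    \<open>u ^ k\<close> of \<open>E\<close> beyond the bound \<open>v t\<close>.\<close>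
  have dual: "x \<in> ?D" if x: "\<And>y. y \<in> ?E \<Longrightarrow> \<psi> (x * y) = 1" for x
  proof (rule ccontr)
    assume "x \<notin> ?D"
    then have v1: "1 < v x" by simp
    have step: "x * y \<in> ?E" if y: "y \<in> ?E" for y
    proof -
      have "\<psi> (z * (x * y)) = 1" if "v z \<le> 1" for z
      proof -
        have "v (z * y) \<le> v y"
          using mult_right_mono[OF that v_nonneg[of y]] by (simp add: v_mult)
        then have "\<psi> (x * (z * y)) = 1" using x E_module[OF y] by blast
        then show ?thesis by (simp add: mult.left_commute)
      qed
      then show ?thesis by simp
    qed
    obtain k where k: "v (u ^ k) < r" using small r(1) by blast
    have "x ^ n * u ^ k \<in> ?E" for n
      using E_ball[OF k] by (induction n) (use step in \<open>auto simp: mult.assoc\<close>)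
    then have b: "v x ^ n * v (u ^ k) < v t" for n
      using E_bound[of "x ^ n * u ^ k"] by (simp add: v_mult v_power)
    have "0 < v (u ^ k)" by (rule v_pos[OF u0])
    moreover obtain n where "v t / v (u ^ k) < v x ^ n" using real_arch_pow[OF v1] by blast
    ultimately show False using b[of n] by (simp add: field_simps)
  qed
  have sub: "\<exists>D' E'. add_subgroup D' \<and> D' \<subseteq> ?D \<inter> U \<and> finite_index ?D D' \<and>
      (\<forall>x\<in>?D - D'. \<exists>y. \<psi> (x * y) \<noteq> 1 \<and> (\<forall>z\<in>D'. \<psi> (z * y) = 1)) \<and>
      add_subgroup E' \<and> E' \<subseteq> ?E \<inter> U \<and> finite_index ?E E' \<and>
      (\<forall>x\<in>?E - E'. \<exists>y. \<psi> (x * y) \<noteq> 1 \<and> (\<forall>z\<in>E'. \<psi> (z * y) = 1))"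
    if U: "openin T U" "0 \<in> U" for U
  proof -
    obtain s where s: "0 < s" "\<And>y. v y < s \<Longrightarrow> y \<in> U" using ball_in_open U unfolding T by blast
    have vt: "0 < v t" by (rule v_pos[OF t0])
    \<comment> \<open>The sublattices are \<open>c D\<close> and \<open>c E\<close>. The three
      bounds on \<open>v c\<close> give, in turn, inclusion in the lattices, \<open>D'\<close>
      inside \<open>U\<close>, and \<open>E'\<close> inside \<open>U\<close>, the last because
      \<open>E\<close> is bounded by \<open>v t\<close>.\<close>
    obtain k where k: "v (u ^ k) < min 1 (min s (s / v t))" using small[of "min 1 (min s (s / v t))"] s(1) vt by auto
    define c where "c = u ^ k"
    have c0: "c \<noteq> 0" using u0 by (simp add: c_def)
    have c: "v c < 1" "v c < s" "v c * v t < s" using k vt by (simp_all add: c_def field_simps)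
    have vc: "0 < v c" by (rule v_pos[OF c0])
    define D' where "D' = {x. v x \<le> v c}"
    define E' where "E' = (*) c ` ?E"
    have D'1: "add_subgroup D'" unfolding D'_def by (rule subgroup_cball) (rule v_nonneg)
    have D'2: "D' \<subseteq> ?D \<inter> U" using c s(2) by (auto simp: D'_def)
    have D'3: "finite_index ?D D'"
      using finite_index_cball[OF u fin c0, of 1] by (simp add: D'_def v_1)
    have D'4: "\<exists>y. \<psi> (x * y) \<noteq> 1 \<and> (\<forall>z\<in>D'. \<psi> (z * y) = 1)" if "x \<in> ?D - D'" for x
    proof -
      \<comment> \<open>\<open>x / c\<close> is outside \<open>D\<close>, so biduality yields
        \<open>y\<close> in \<open>E\<close> detecting it; \<open>y / c\<close> detects
        \<open>x\<close> and is trivial on \<open>D'\<close>.\<close>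
      have "v (x / c) > 1" using that vc c0 by (simp add: D'_def v_divide)
      then obtain y where y: "y \<in> ?E" "\<psi> (x / c * y) \<noteq> 1" using dual[of "x / c"] by force
      have "\<psi> (z * (y / c)) = 1" if "z \<in> D'" for z
      proof -
        have "v (z / c) \<le> 1" using that vc c0 by (simp add: D'_def v_divide)
        then have "\<psi> (z / c * y) = 1" using y(1) by blast
        then show ?thesis by simp
      qed
      moreover have "\<psi> (x * (y / c)) \<noteq> 1" using y(2) by simp
      ultimately show ?thesis by blast
    qed
    have E'1: "add_subgroup E'"
      unfolding add_subgroup_def
    proof (intro conjI ballI)
      show "0 \<in> E'" unfolding E'_def by (rule image_eqI[of _ _ 0]) (simp_all add: psi0)
      fix x y assume "x \<in> E'" "y \<in> E'"
      then obtain e f where ef: "x = c * e" "y = c * f" "e \<in> ?E" "f \<in> ?E" unfolding E'_def by blast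
      have "x - y = c * (e - f)" by (simp add: ef right_diff_distrib)
      then show "x - y \<in> E'" unfolding E'_def using add_subgroupD(2)[OF E_sub ef(3,4)] by (rule image_eqI)
    qed
    have E'2: "E' \<subseteq> ?E \<inter> U"
    proof
      fix x assume "x \<in> E'"
      then obtain e where e: "x = c * e" "e \<in> ?E" unfolding E'_def by blast
      have "v c * v e \<le> 1 * v e" using c(1) v_nonneg[of e] by (intro mult_right_mono) simp_all
      then have "v x \<le> v e" by (simp add: e v_mult)
      moreover have "v x < s"
      proof -
        have "v c * v e \<le> v c * v t" using E_bound[OF e(2)] vc by (intro mult_left_mono) auto
        then show ?thesis using c(3) by (simp add: e(1) v_mult)
      qed
      ultimately show "x \<in> ?E \<inter> U" using E_module[OF e(2)] s(2) by blast
    qed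
    have E'3: "finite_index ?E E'"
    proof -
      obtain m where m: "v (u ^ m) < r" using small r(1) by blast
      let ?a = "c * u ^ m"
      have a0: "?a \<noteq> 0" using c0 u0 by simp
      \<comment> \<open>\<open>E\<close> contains the ball of radius \<open>v (u ^ m)\<close> and
        lies in the ball of radius \<open>v t\<close>. Hence \<open>E'\<close> contains a ball whose
        index in the large one is finite.\<close>
      have "{x. v x \<le> v ?a} \<subseteq> E'"
      proof
        fix x assume "x \<in> {x. v x \<le> v ?a}"
        then have "v (x / c) \<le> v (u ^ m)" using c0 vc by (simp add: v_divide v_mult field_simps)
        then have "x / c \<in> ?E" using m by (intro E_ball) simp
        moreover have "x = c * (x / c)" using c0 by simp
        ultimately show "x \<in> E'" unfolding E'_def by blast
      qed
      moreover have "finite_index ?E {x. v x \<le> v ?a}"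
      proof (rule finite_index_subset)
        show "finite_index {x. v x \<le> v t} {x. v x \<le> v ?a}" by (rule finite_index_cball[OF u fin a0 t0])
        show "add_subgroup {x. v x \<le> v ?a}" by (rule subgroup_cball) (rule v_nonneg)
        show "?E \<subseteq> {x. v x \<le> v t}" using E_bound less_imp_le by blast
      qed
      ultimately show ?thesis using finite_index_mono by blast
    qed
    have E'4: "\<exists>y. \<psi> (x * y) \<noteq> 1 \<and> (\<forall>z\<in>E'. \<psi> (z * y) = 1)" if "x \<in> ?E - E'" for x
    proof -
      have "x = c * (x / c)" using c0 by simp
      then have "x / c \<notin> ?E" using that unfolding E'_def by blast
      then obtain d where d: "v d \<le> 1" "\<psi> (d * (x / c)) \<noteq> 1" by blast
      have "\<psi> (z * (d / c)) = 1" if "z \<in> E'" for z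
      proof -
        obtain e where e: "z = c * e" "e \<in> ?E" using \<open>z \<in> E'\<close> unfolding E'_def by blast
        then have "\<psi> (d * e) = 1" using d(1) by blast
        then show ?thesis using c0 by (simp add: e(1) mult.commute)
      qed
      moreover have "\<psi> (x * (d / c)) \<noteq> 1" using d(2) by (simp add: mult.commute)
      ultimately show ?thesis by blast
    qed
    show ?thesis
      using D'1 D'2 D'3 D'4 E'1 E'2 E'3 E'4 by (intro exI[of _ D'] exI[of _ E'] conjI ballI)
  qed
  show ?thesis
  proof (intro dual_lattices.intro dual_lattices_axioms.intro)
    show "linear_topology T" unfolding T by (rule linear_topology_abs)
    show "\<exists>U. openin T U \<and> 0 \<in> U \<and> (\<forall>y\<in>U. \<psi> y = 1)" using U by blast
    have "openin T {x. v x < r}" "0 \<in> {x. v x < r}" "{x. v x < r} \<subseteq> ?E"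
      unfolding T using open_ball[OF r(1)] r(1) E_ball by (simp_all add: v_0 subset_iff)
    then show "\<exists>U. openin T U \<and> 0 \<in> U \<and> U \<subseteq> ?E" by blast
    have "openin T {x. v x < 1}" "0 \<in> {x. v x < 1}" "{x. v x < 1} \<subseteq> ?D"
      unfolding T using open_ball[of 1] by (simp_all add: v_0 subset_iff)
    then show "\<exists>U. openin T U \<and> 0 \<in> U \<and> U \<subseteq> ?D" by blast
    show "\<psi> (x * y) = 1" if "x \<in> ?D" "y \<in> ?E" for x y using that by simp
    show "y \<in> ?E" if "\<And>x. x \<in> ?D \<Longrightarrow> \<psi> (x * y) = 1" for y using that by simp
  qed (fact mult nz D_sub E_sub dual sub)+
qed

end

lemma dual_lattices_base_field:
  assumes "base_field T p" "smooth_character T \<psi>" "\<psi> t \<noteq> 1"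
  obtains D E where "dual_lattices T \<psi> D E"
proof -
  consider "finite (UNIV :: 'a set)" "T = discrete_topology UNIV"
    | v where "nonarch_local_field v" "T = abs_topology v"
    using assms(1) unfolding base_field_def by blast
  then show ?thesis
  proof cases
    case 1
    then show ?thesis using dual_lattices_finite assms that by blast
  next
    case 2
    then interpret nonarch v by unfold_locales (simp add: nonarch_local_field_def)
    show ?thesis using dual_lattices_local[OF 2 assms(2,3)] that by blast
  qed
qed

section \<open>The lattice of the Heisenberg group\<close>

context linear_topology begin

lemma small_multiples:
  assumes "finite C" "openin T U" "0 \<in> U"
  shows "\<exists>N. openin T N \<and> add_subgroup N \<and> N \<subseteq> U \<and> (\<forall>c\<in>C. \<forall>x\<in>N. c * x \<in> U)"
  using assms(1)
proof (induction C rule: finite_induct)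
  case empty
  then show ?case using small_subgroup[OF assms(2,3)] by simp
next
  case (insert c C)
  then obtain N1 where N1: "openin T N1" "add_subgroup N1" "N1 \<subseteq> U" "\<forall>c\<in>C. \<forall>x\<in>N1. c * x \<in> U"
    by (elim exE conjE) simp
  obtain N2 where N2: "openin T N2" "0 \<in> N2" "\<forall>x\<in>N2. c * x \<in> U"
    using scaling[OF assms(2,3), of c] by (elim exE conjE) simp
  have "openin T (N1 \<inter> N2)" "0 \<in> N1 \<inter> N2"
    using N1 N2 add_subgroupD(1) by auto
  from small_subgroup[OF this] obtain N where N: "openin T N" "add_subgroup N" "N \<subseteq> N1 \<inter> N2"
    by (elim exE conjE) simp
  have "\<forall>d\<in>insert c C. \<forall>x\<in>N. d * x \<in> U" "N \<subseteq> U" using N(3) N1 N2 by auto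
  then show ?case using N by (intro exI[of _ N]) simp
qed

end

locale heisenberg_lattice = symplectic scaleW B form + dual_lattices T \<psi> D E
  for scaleW :: "'f::field \<Rightarrow> 'w::ab_group_add \<Rightarrow> 'w" and B form
    and T and \<psi> :: "'f \<Rightarrow> 'r::field" and D E +
  fixes n :: nat and e f :: "nat \<Rightarrow> 'w"
  assumes two: "(2 :: 'f) \<noteq> 0"
    and hyperbolic: "hyperbolic n e f"
    and expansion: "w = (\<Sum>i<n. scaleW (form w (f i)) (e i)) + (\<Sum>i<n. scaleW (form (e i) w) (f i))"
begin

text \<open>The coefficient of \<open>e i\<close> in \<open>w\<close> is \<open>form w (f i)\<close>
  and that of \<open>f i\<close> is \<open>form (e i) w\<close>. So \<beta> multiplies
  \<open>f\<close>-coordinates by \<open>e\<close>-coordinates, and on \<open>lattice D E\<close>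
  its terms are products of elements of \<open>E\<close> and \<open>D\<close>, on which
  \<open>\<psi>\<close> is trivial.\<close>

definition \<beta> :: "'w \<Rightarrow> 'w \<Rightarrow> 'f" where
  "\<beta> w w' = (\<Sum>i<n. form (e i) w * form w' (f i))"

definition \<kappa> :: "'w \<Rightarrow> 'w \<Rightarrow> 'r" where
  "\<kappa> w w' = \<psi> (- \<beta> w w')"

text \<open>Multiplying \<open>(w, 0)\<close> by the central element \<open>q w\<close> gives \<open>(x, 0) \<cdot> (y, 0)\<close> for the
  decomposition \<open>w = x + y\<close>; on the lattice this is a homomorphic section modulo \<open>ker \<psi>\<close>, also in
  residual characteristic \<open>2\<close>.\<close>

definition q :: "'w \<Rightarrow> 'f" where
  "q w = \<beta> w w / 2"

definition lattice :: "'f set \<Rightarrow> 'f set \<Rightarrow> 'w set" where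
  "lattice X Y = {w. \<forall>i<n. form w (f i) \<in> X \<and> form (e i) w \<in> Y}"

lemma psi_0: "\<psi> 0 = 1"
  using psi_add[of 0 0] psi_nonzero[of 0] by simp

lemma psi_uminus: "\<psi> (- x) = inverse (\<psi> x)"
  using psi_add[of x "- x"] psi_nonzero[of x] by (simp add: psi_0 field_simps)

lemma psi_diff: "\<psi> (x - y) = \<psi> x / \<psi> y"
  using psi_add[of x "- y"] by (simp add: psi_uminus field_simps)

lemma psi_sum_trivial: "(\<And>i. i \<in> I \<Longrightarrow> \<psi> (g i) = 1) \<Longrightarrow> \<psi> (\<Sum>i\<in>I. g i) = 1"
  by (induction I rule: infinite_finite_induct) (simp_all add: psi_0 psi_add)

lemma beta_add: "\<beta> (w + w') z = \<beta> w z + \<beta> w' z" "\<beta> z (w + w') = \<beta> z w + \<beta> z w'"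
  by (simp_all add: \<beta>_def form_bilinear sum.distrib distrib_left distrib_right)

lemma beta_zero: "\<beta> 0 z = 0" "\<beta> z 0 = 0"
  by (simp_all add: \<beta>_def form_zero)

lemma form_eq_beta: "form w w' = \<beta> w' w - \<beta> w w'"
proof -
  have "form w w' = (\<Sum>i<n. form w (f i) * form (e i) w') + (\<Sum>i<n. form (e i) w * form (f i) w')"
    by (subst expansion[of w]) (simp add: form_bilinear form_sum)
  also have "(\<Sum>i<n. form (e i) w * form (f i) w') = - \<beta> w w'"
    by (simp add: \<beta>_def sum_negf [symmetric] form_commute[of "f _" w'])
  finally show ?thesis by (simp add: \<beta>_def mult.commute)
qed

text \<open>The coboundary of \<open>q\<close> is the symmetric half of \<beta> and
  \<open>form w w' / 2\<close> is its antisymmetric half; combining them leaves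
  \<open>- \<beta> w w'\<close>. This is the origin of the sign in \<kappa>.\<close>

lemma q_add: "q w + q w' + form w w' / 2 = q (w + w') - \<beta> w w'"
proof -
  have "\<beta> w w' = (\<beta> w w' + \<beta> w w') / 2" using two by (simp add: mult_2 [symmetric])
  then have "q (w + w') - \<beta> w w' = (\<beta> (w + w') (w + w') - (\<beta> w w' + \<beta> w w')) / 2"
    by (simp add: q_def diff_divide_distrib)
  also have "\<dots> = (\<beta> w w + \<beta> w' w' + (\<beta> w' w - \<beta> w w')) / 2"
    by (simp add: beta_add algebra_simps)
  finally show ?thesis by (simp add: q_def form_eq_beta add_divide_distrib)
qed

lemma q_zero: "q 0 = 0"
  by (simp add: q_def beta_zero)

lemma
  assumes "i < n" "j < n"
  shows form_ee: "form (e i) (e j) = 0" and form_ff: "form (f i) (f j) = 0"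
    and form_ef: "form (e i) (f j) = (if i = j then 1 else 0)"
  using hyperbolic assms by (simp_all add: hyperbolic_def)

lemma form_combination:
  assumes "j < n"
  shows "form ((\<Sum>i<n. scaleW (a i) (e i)) + (\<Sum>i<n. scaleW (b i) (f i))) (f j) = a j"
    "form (e j) ((\<Sum>i<n. scaleW (a i) (e i)) + (\<Sum>i<n. scaleW (b i) (f i))) = b j"
proof -
  have "(\<Sum>i<n. a i * form (e i) (f j)) = (\<Sum>i<n. if i = j then a i else 0)"
    using assms by (intro sum.cong) (simp_all add: form_ef)
  moreover have "(\<Sum>i<n. b i * form (f i) (f j)) = 0"
    using assms by (intro sum.neutral) (simp add: form_ff)
  ultimately show "form ((\<Sum>i<n. scaleW (a i) (e i)) + (\<Sum>i<n. scaleW (b i) (f i))) (f j) = a j"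
    using assms by (simp add: form_bilinear form_sum)
  have "(\<Sum>i<n. b i * form (e j) (f i)) = (\<Sum>i<n. if i = j then b i else 0)"
    using assms by (intro sum.cong) (auto simp: form_ef)
  moreover have "(\<Sum>i<n. a i * form (e j) (e i)) = 0"
    using assms by (intro sum.neutral) (simp add: form_ee)
  ultimately show "form (e j) ((\<Sum>i<n. scaleW (a i) (e i)) + (\<Sum>i<n. scaleW (b i) (f i))) = b j"
    using assms by (simp add: form_bilinear form_sum)
qed

lemma lattice_subgroup:
  assumes "add_subgroup X" "add_subgroup Y"
  shows "add_subgroup (lattice X Y)"
  unfolding add_subgroup_def lattice_def
  by (simp add: form_zero form_diff add_subgroupD(1,2)[OF assms(1)] add_subgroupD(1,2)[OF assms(2)])

lemma lattice_scale_e: "i < n \<Longrightarrow> z \<in> D \<Longrightarrow> scaleW z (e i) \<in> lattice D E"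
  by (auto simp: lattice_def form_bilinear form_ee form_ef add_subgroupD(1)[OF D_subgroup]
      add_subgroupD(1)[OF E_subgroup])

lemma lattice_scale_f: "i < n \<Longrightarrow> z \<in> E \<Longrightarrow> scaleW z (f i) \<in> lattice D E"
  by (auto simp: lattice_def form_bilinear form_ff form_ef add_subgroupD(1)[OF D_subgroup]
      add_subgroupD(1)[OF E_subgroup])

lemma kappa_comm: "\<kappa> w w' / \<kappa> w' w = \<psi> (form w w')"
  by (simp add: \<kappa>_def form_eq_beta psi_diff psi_uminus field_simps)

text \<open>Self-duality is checked one coordinate at a time: multiples of \<open>f i\<close> by
  \<open>E\<close> test the \<open>e i\<close>-coordinate of \<open>w\<close>, and multiples of
  \<open>e i\<close> by \<open>D\<close> test the \<open>f i\<close>-coordinate.\<close>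

sublocale polarized_bicharacter \<kappa> "lattice D E"
proof
  show "\<kappa> w w' \<noteq> 0" for w w' by (simp add: \<kappa>_def psi_nonzero)
  show "\<kappa> (w + w') z = \<kappa> w z * \<kappa> w' z" "\<kappa> z (w + w') = \<kappa> z w * \<kappa> z w'" for w w' z
    by (simp_all add: \<kappa>_def beta_add psi_add [symmetric])
  note sub = add_subgroupD[OF lattice_subgroup[OF D_subgroup E_subgroup]]
  show "0 \<in> lattice D E" by (rule sub(1))
  show "l + l' \<in> lattice D E" if "l \<in> lattice D E" "l' \<in> lattice D E" for l l' using that by (rule sub(4))
  show "- l \<in> lattice D E" if "l \<in> lattice D E" for l using that by (rule sub(3))
  show "\<kappa> l l' = 1" if l: "l \<in> lattice D E" "l' \<in> lattice D E" for l l'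
  proof -
    have "\<psi> (\<beta> l l') = 1"
      unfolding \<beta>_def
    proof (rule psi_sum_trivial)
      fix i assume "i \<in> {..<n}"
      then have "\<psi> (form l' (f i) * form (e i) l) = 1" using l by (intro pairing) (simp_all add: lattice_def)
      then show "\<psi> (form (e i) l * form l' (f i)) = 1" by (simp add: mult.commute)
    qed
    then show ?thesis by (simp add: \<kappa>_def psi_uminus)
  qed
  show "w \<in> lattice D E" if w: "\<And>l. l \<in> lattice D E \<Longrightarrow> \<kappa> l w = \<kappa> w l" for w
  proof -
    have 1: "\<psi> (form l w) = 1" if "l \<in> lattice D E" for l
      using kappa_comm[of l w] w[OF that] by (simp add: \<kappa>_def psi_nonzero)
    have "form w (f i) \<in> D" if i: "i < n" for i
    proof (rule dual_E)
      fix z assume "z \<in> E"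
      then have "scaleW (- z) (f i) \<in> lattice D E"
        using i by (intro lattice_scale_f add_subgroupD(3)[OF E_subgroup])
      from 1[OF this] show "\<psi> (form w (f i) * z) = 1"
        by (simp add: form_bilinear form_uminus form_commute[of w] mult.commute)
    qed
    moreover have "form (e i) w \<in> E" if i: "i < n" for i
    proof (rule dual_D)
      fix z assume "z \<in> D"
      from 1[OF lattice_scale_e[OF i this]] show "\<psi> (z * form (e i) w) = 1"
        by (simp add: form_bilinear)
    qed
    ultimately show ?thesis by (simp add: lattice_def)
  qed
qed

lemma comm_eq_psi: "comm w w' = \<psi> (form w w')"
  by (simp add: comm_def kappa_comm)

text \<open>Everything is coordinatewise: \<open>K\<close> consists of the vectors whose coordinates
  are chosen representatives, and an \<open>l\<close> outside \<open>M\<close> has a bad coordinate,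
  which a multiple of the dual basis vector detects alone.\<close>

lemma small_finite_level:
  assumes U: "openin T U" "0 \<in> U"
  shows "\<exists>M. finite_level M \<and> M \<subseteq> lattice (D \<inter> U) (E \<inter> U)"
proof -
  obtain D' E' where D': "add_subgroup D'" "D' \<subseteq> D \<inter> U" "finite_index D D'"
      "\<forall>x\<in>D - D'. \<exists>y. \<psi> (x * y) \<noteq> 1 \<and> (\<forall>z\<in>D'. \<psi> (z * y) = 1)"
    and E': "add_subgroup E'" "E' \<subseteq> E \<inter> U" "finite_index E E'"
      "\<forall>x\<in>E - E'. \<exists>y. \<psi> (x * y) \<noteq> 1 \<and> (\<forall>z\<in>E'. \<psi> (z * y) = 1)"
    using sublattices[OF U] by (elim exE conjE) simp
  define M where "M = lattice D' E'"
  have M: "M \<subseteq> lattice (D \<inter> U) (E \<inter> U)" using D'(2) E'(2) by (auto simp: M_def lattice_def)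
  have "M \<subseteq> lattice D E" using M by (auto simp: lattice_def)
  moreover have "add_subgroup M" unfolding M_def by (rule lattice_subgroup[OF D'(1) E'(1)])
  moreover have "\<exists>I. finite I \<and> (\<forall>l\<in>lattice D E. \<exists>i\<in>I. l - i \<in> M)"
  proof -
    obtain I where I: "finite I" "\<And>d. d \<in> D \<Longrightarrow> \<exists>i\<in>I. d - i \<in> D'"
      using D'(3) unfolding finite_index_def by (elim exE conjE) simp
    obtain J where J: "finite J" "\<And>d. d \<in> E \<Longrightarrow> \<exists>i\<in>J. d - i \<in> E'"
      using E'(3) unfolding finite_index_def by (elim exE conjE) simp
    define K where "K = (\<lambda>(a, b). (\<Sum>i<n. scaleW (a i) (e i)) + (\<Sum>i<n. scaleW (b i) (f i))) `
      (PiE {..<n} (\<lambda>_. I) \<times> PiE {..<n} (\<lambda>_. J))"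
    have "finite K" unfolding K_def using I(1) J(1) by (intro finite_imageI finite_SigmaI finite_PiE) simp_all
    moreover have "\<exists>k\<in>K. l - k \<in> M" if l: "l \<in> lattice D E" for l
    proof -
      have "\<forall>i\<in>{..<n}. \<exists>a. a \<in> I \<and> form l (f i) - a \<in> D'"
      proof
        fix i assume "i \<in> {..<n}"
        then have "form l (f i) \<in> D" using l by (simp add: lattice_def)
        from I(2)[OF this] show "\<exists>a. a \<in> I \<and> form l (f i) - a \<in> D'" by blast
      qed
      from bchoice[OF this] obtain a where a: "\<forall>i\<in>{..<n}. a i \<in> I \<and> form l (f i) - a i \<in> D'" ..
      have "\<forall>i\<in>{..<n}. \<exists>b. b \<in> J \<and> form (e i) l - b \<in> E'"
      proof
        fix i assume "i \<in> {..<n}"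
        then have "form (e i) l \<in> E" using l by (simp add: lattice_def)
        from J(2)[OF this] show "\<exists>b. b \<in> J \<and> form (e i) l - b \<in> E'" by blast
      qed
      from bchoice[OF this] obtain b where b: "\<forall>i\<in>{..<n}. b i \<in> J \<and> form (e i) l - b i \<in> E'" ..
      let ?a = "restrict a {..<n}" and ?b = "restrict b {..<n}"
      let ?k = "(\<Sum>i<n. scaleW (?a i) (e i)) + (\<Sum>i<n. scaleW (?b i) (f i))"
      have "(?a, ?b) \<in> PiE {..<n} (\<lambda>_. I) \<times> PiE {..<n} (\<lambda>_. J)"
        using a b by auto
      then have "?k \<in> K" unfolding K_def by (rule rev_image_eqI) (simp only: prod.case)
      moreover have "l - ?k \<in> M"
        unfolding M_def lattice_def mem_Collect_eq
      proof (intro allI impI)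
        fix i assume i: "i < n"
        have "form ?k (f i) = a i" "form (e i) ?k = b i"
          using form_combination[OF i, of ?a ?b] i by (simp_all only: restrict_apply' lessThan_iff)
        then show "form (l - ?k) (f i) \<in> D' \<and> form (e i) (l - ?k) \<in> E'"
          using a b i by (simp only: form_diff) simp
      qed
      ultimately show ?thesis by (rule bexI[rotated])
    qed
    ultimately show ?thesis by (intro exI[of _ K]) simp
  qed
  moreover have "\<exists>w. comm l w \<noteq> 1 \<and> (\<forall>m\<in>M. comm m w = 1)" if l: "l \<in> lattice D E - M" for l
  proof -
    obtain i where i: "i < n" and "form l (f i) \<notin> D' \<or> form (e i) l \<notin> E'"
      using l unfolding M_def lattice_def by auto
    then consider "form l (f i) \<in> D - D'" | "form (e i) l \<in> E - E'"
      using l i unfolding lattice_def by auto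
    then show ?thesis
    proof cases
      case 1
      from bspec[OF D'(4) this] obtain y
        where y: "\<psi> (form l (f i) * y) \<noteq> 1" "\<forall>z\<in>D'. \<psi> (z * y) = 1"
        by (elim exE conjE)
      have "comm w (scaleW y (f i)) = \<psi> (form w (f i) * y)" for w
        by (simp add: comm_eq_psi form_bilinear mult.commute)
      then show ?thesis using y i by (intro exI[of _ "scaleW y (f i)"]) (simp add: M_def lattice_def)
    next
      case 2
      from bspec[OF E'(4) this] obtain y
        where y: "\<psi> (form (e i) l * y) \<noteq> 1" "\<forall>z\<in>E'. \<psi> (z * y) = 1"
        by (elim exE conjE)
      have "comm w (scaleW (- y) (e i)) = \<psi> (form (e i) w * y)" for w
        by (simp add: comm_eq_psi form_bilinear form_uminus form_commute[of w] mult.commute)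
      then show ?thesis using y i by (intro exI[of _ "scaleW (- y) (e i)"]) (simp add: M_def lattice_def)
    qed
  qed
  ultimately have "finite_level M" by (auto simp: finite_level_def add_subgroup_def)
  then show ?thesis using M by blast
qed

end

section \<open>Topology of the Heisenberg group\<close>

context twisted_rep begin

lemma twisted_rep_stable:
  assumes "stable U" shows "twisted_rep \<kappa> L scl U A"
proof -
  have U: "x \<in> V" if "x \<in> U" for x using that assms by (auto simp: stable_def)
  show ?thesis
    by unfold_locales (use assms U in \<open>auto simp: stable_def A_add A_scale A_zero A_mult\<close>)
qed

end

context heisenberg_lattice begin

text \<open>Neighbourhoods of the identity in coordinates for the given basis \<open>B\<close>,
  which defines the topology. The lattice uses the symplectic basis instead;
  \<open>small_form\<close> and \<open>small_coordinates\<close> pass between the two.\<close>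

definition box :: "'f set \<Rightarrow> ('w \<times> 'f) set" where
  "box U = {(w, t). (\<forall>b\<in>B. representation B w b \<in> U) \<and> t \<in> U}"

lemma representation_linear:
  "representation B (w + w') b = representation B w b + representation B w' b"
  "representation B (w - w') b = representation B w b - representation B w' b"
  "representation B (scaleW c w) b = c * representation B w b"
  by (simp_all add: representation_add representation_diff representation_scale independent_Basis
      span_Basis)

lemma representation_finite_sum:
  "representation B (\<Sum>i\<in>I. g i) b = (\<Sum>i\<in>I. representation B (g i) b)"
  by (induction I rule: infinite_finite_induct) (simp_all add: representation_zero representation_linear)

text \<open>The translate is taken for addition and not for the group law;
  \<open>open_stabilizer\<close> accounts for the difference.\<close>

lemma open_translated_box:
  assumes U: "openin T U" "0 \<in> U"
  shows "openin (heisenberg_topology scaleW B T) {(w', t'). (w' - w, t' - t) \<in> box U}"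
proof -
  let ?X = "coord_topology scaleW B T"
  have shift: "openin T ((+) a ` U)" for a by (rule translate[OF U(1)])
  have mem: "y \<in> (+) a ` U \<longleftrightarrow> y - a \<in> U" for y a
    by (force simp: image_iff algebra_simps)
  have "openin ?X {w'. \<forall>b\<in>B. representation B (w' - w) b \<in> U}"
    unfolding coord_topology_def openin_pullback_topology
  proof (intro exI conjI)
    show "openin (product_topology (\<lambda>_. T) B) (PiE B (\<lambda>b. (+) (representation B w b) ` U))"
      using shift by (simp add: openin_PiE finite_Basis)
    show "{w'. \<forall>b\<in>B. representation B (w' - w) b \<in> U} =
      (\<lambda>w. \<lambda>b\<in>B. representation B w b) -` PiE B (\<lambda>b. (+) (representation B w b) ` U) \<inter> UNIV"
    proof (rule Set.set_eqI)
      fix w'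
      have "representation B w' b \<in> (+) (representation B w b) ` U \<longleftrightarrow>
          representation B (w' - w) b \<in> U" for b
        by (simp only: mem representation_linear(2))
      then show "w' \<in> {w'. \<forall>b\<in>B. representation B (w' - w) b \<in> U} \<longleftrightarrow>
        w' \<in> (\<lambda>w. \<lambda>b\<in>B. representation B w b) -`
          PiE B (\<lambda>b. (+) (representation B w b) ` U) \<inter> UNIV"
        by (simp add: PiE_iff)
    qed
  qed
  moreover have "openin T {t'. t' - t \<in> U}"
  proof -
    have "{t'. t' - t \<in> U} = (+) t ` U" using mem by auto
    then show ?thesis using shift by simp
  qed
  ultimately have "openin (heisenberg_topology scaleW B T)
      ({w'. \<forall>b\<in>B. representation B (w' - w) b \<in> U} \<times> {t'. t' - t \<in> U})"
    unfolding heisenberg_topology_def by (simp add: openin_prod_Times_iff)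
  also have "{w'. \<forall>b\<in>B. representation B (w' - w) b \<in> U} \<times> {t'. t' - t \<in> U} =
      {(w', t'). (w' - w, t' - t) \<in> box U}"
    by (auto simp: box_def)
  finally show ?thesis .
qed

lemma box_in_open:
  assumes K: "openin (heisenberg_topology scaleW B T) K" "(0, 0) \<in> K"
  shows "\<exists>U. openin T U \<and> 0 \<in> U \<and> box U \<subseteq> K"
proof -
  have "\<exists>X Y. openin (coord_topology scaleW B T) X \<and> openin T Y \<and> 0 \<in> X \<and> 0 \<in> Y \<and> X \<times> Y \<subseteq> K"
    using K unfolding heisenberg_topology_def openin_prod_topology_alt by simp
  then obtain X Y where XY: "openin (coord_topology scaleW B T) X" "openin T Y" "0 \<in> X" "0 \<in> Y"
    "X \<times> Y \<subseteq> K" by (elim exE conjE)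
  obtain Q where Q: "openin (product_topology (\<lambda>_. T) B) Q"
    "X = (\<lambda>w. \<lambda>b\<in>B. representation B w b) -` Q \<inter> UNIV"
    using XY(1) unfolding coord_topology_def openin_pullback_topology by (elim exE conjE)
  have "(\<lambda>b\<in>B. 0) \<in> Q" using XY(3) by (simp add: Q(2) representation_zero)
  from bspec[OF Q(1) [unfolded openin_product_topology_alt] this] obtain Z
    where Z: "\<forall>b\<in>B. openin T (Z b)" "(\<lambda>b\<in>B. 0) \<in> PiE B Z" "PiE B Z \<subseteq> Q"
    by (elim exE conjE)
  let ?U = "Y \<inter> (\<Inter>b\<in>B. Z b) \<inter> topspace T"
  have "openin T ?U"
  proof (cases "B = {}")
    case True
    then show ?thesis using XY(2) topspace by simp
  next
    case False
    then show ?thesis using XY(2) Z(1) finite_Basis by (intro openin_Int openin_INT2) auto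
  qed
  moreover have "0 \<in> ?U" using XY(4) Z(2) topspace by (auto simp: PiE_iff)
  moreover have "box ?U \<subseteq> K"
  proof
    fix h assume "h \<in> box ?U"
    then obtain w t where h: "h = (w, t)" "\<forall>b\<in>B. representation B w b \<in> ?U" "t \<in> ?U"
      by (auto simp: box_def)
    have "(\<lambda>b\<in>B. representation B w b) \<in> PiE B Z" using h(2) by auto
    from subsetD[OF Z(3) this] have "w \<in> X" by (simp add: Q(2))
    then show "h \<in> K" using XY(5) h by auto
  qed
  ultimately show ?thesis by blast
qed

text \<open>\<open>form w z\<close> is a combination of the \<open>B\<close>-coordinates of
  \<open>w\<close> with coefficients \<open>form b z\<close>, of which there are finitely many; a
  small open subgroup absorbs both the coefficients and the sum.\<close>

lemma small_form:
  assumes "finite Z" "openin T U" "0 \<in> U"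
  shows "\<exists>N. openin T N \<and> 0 \<in> N \<and> N \<subseteq> U \<and>
    (\<forall>w. (\<forall>b\<in>B. representation B w b \<in> N) \<longrightarrow> (\<forall>z\<in>Z. form w z \<in> U))"
proof -
  obtain U' where U': "openin T U'" "add_subgroup U'" "U' \<subseteq> U"
    using small_subgroup[OF assms(2,3)] by (elim exE conjE)
  have "finite ((\<lambda>(b, z). form b z) ` (B \<times> Z))" using finite_Basis assms(1) by simp
  from small_multiples[OF this U'(1) add_subgroupD(1)[OF U'(2)]]
  obtain N where N: "openin T N" "add_subgroup N" "N \<subseteq> U'"
    "\<forall>c\<in>(\<lambda>(b, z). form b z) ` (B \<times> Z). \<forall>x\<in>N. c * x \<in> U'"
    by (elim exE conjE)
  have "form w z \<in> U" if w: "\<forall>b\<in>B. representation B w b \<in> N" and z: "z \<in> Z" for w z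
  proof -
    have "w = (\<Sum>b\<in>B. scaleW (representation B w b) b)"
      using sum_representation_eq[OF independent_Basis _ finite_Basis order_refl, of w] span_Basis by simp
    then have "form w z = form (\<Sum>b\<in>B. scaleW (representation B w b) b) z" by simp
    also have "\<dots> = (\<Sum>b\<in>B. form b z * representation B w b)"
      by (simp add: form_sum form_bilinear mult.commute)
    also have "\<dots> \<in> U'"
    proof (rule add_subgroup_sum[OF U'(2)])
      fix b assume b: "b \<in> B"
      then have "form b z \<in> (\<lambda>(b, z). form b z) ` (B \<times> Z)" using z by force
      then show "form b z * representation B w b \<in> U'" using N(4) w b by blast
    qed
    finally show ?thesis using U'(3) by blast
  qed
  then show ?thesis using N U'(3) add_subgroupD(1)[OF N(2)] by (intro exI[of _ N]) auto
qed

lemma small_coordinates: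
  assumes "openin T U" "0 \<in> U"
  shows "\<exists>N. openin T N \<and> 0 \<in> N \<and> (\<forall>w\<in>lattice N N. \<forall>b\<in>B. representation B w b \<in> U)"
proof -
  obtain U' where U': "openin T U'" "add_subgroup U'" "U' \<subseteq> U"
    using small_subgroup[OF assms] by (elim exE conjE)
  define C where "C = (\<lambda>(i, b). representation B (e i) b) ` ({..<n} \<times> B) \<union>
    (\<lambda>(i, b). representation B (f i) b) ` ({..<n} \<times> B)"
  have "finite C" using finite_Basis by (simp add: C_def)
  from small_multiples[OF this U'(1) add_subgroupD(1)[OF U'(2)]]
  obtain N where N: "openin T N" "add_subgroup N" "\<forall>c\<in>C. \<forall>x\<in>N. c * x \<in> U'"
    by (elim exE conjE)
  have "representation B w b \<in> U" if w: "w \<in> lattice N N" and b: "b \<in> B" for w b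
  proof -
    have "representation B w b = (\<Sum>i<n. representation B (e i) b * form w (f i)) +
        (\<Sum>i<n. representation B (f i) b * form (e i) w)"
      by (subst expansion[of w]) (simp add: representation_linear representation_finite_sum mult.commute)
    also have "\<dots> \<in> U'"
    proof (intro add_subgroupD(4)[OF U'(2)] add_subgroup_sum[OF U'(2)])
      fix i assume i: "i \<in> {..<n}"
      have "representation B (e i) b \<in> C" "representation B (f i) b \<in> C"
        unfolding C_def using i b by force+
      then show "representation B (e i) b * form w (f i) \<in> U'" "representation B (f i) b * form (e i) w \<in> U'"
        using N(3) w i by (auto simp: lattice_def)
    qed
    finally show ?thesis using U'(3) by blast
  qed
  then show ?thesis using N add_subgroupD(1)[OF N(2)] by (intro exI[of _ N]) auto
qed

text \<open>Halving need not preserve \<open>E\<close> in residual characteristic 2, so the 1/2 in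
  \<open>q\<close> is absorbed by a smaller neighbourhood, to which \<open>psi_q_trivial\<close>
  applies.\<close>

lemma half_E_open: "\<exists>U. openin T U \<and> 0 \<in> U \<and> (\<forall>y\<in>U. y / 2 \<in> E)"
proof -
  obtain U where U: "openin T U" "0 \<in> U" "U \<subseteq> E" using E_open by (elim exE conjE)
  from scaling[OF this(1,2), of "1 / 2"] obtain N
    where N: "openin T N" "0 \<in> N" "\<forall>x\<in>N. 1 / 2 * x \<in> U" by (elim exE conjE)
  have "\<forall>y\<in>N. y / 2 \<in> E" using N(3) U(3) by auto
  then show ?thesis using N by (intro exI[of _ N]) simp
qed

lemma psi_q_trivial:
  assumes "\<And>i. i < n \<Longrightarrow> form w (f i) \<in> D" "\<And>i. i < n \<Longrightarrow> form (e i) w / 2 \<in> E"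
  shows "\<psi> (q w) = 1"
proof -
  have "q w = (\<Sum>i<n. form w (f i) * (form (e i) w / 2))"
    by (simp add: q_def \<beta>_def sum_divide_distrib mult.commute)
  moreover have "\<psi> (\<Sum>i<n. form w (f i) * (form (e i) w / 2)) = 1"
    using assms by (intro psi_sum_trivial pairing) auto
  ultimately show ?thesis by simp
qed

lemma heisenberg_simps:
  "carrier (heisenberg form) = UNIV" "\<one>\<^bsub>heisenberg form\<^esub> = (0, 0)"
  "(w, t) \<otimes>\<^bsub>heisenberg form\<^esub> (w', t') = (w + w', t + t' + form w w' / 2)"
  by (simp_all add: heisenberg_def)

section \<open>Passage from representations of the Heisenberg group to twisted
  representations\<close>

context
  fixes scl :: "'r \<Rightarrow> 'v::ab_group_add \<Rightarrow> 'v" and V \<pi>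
  assumes rep: "group_rep (heisenberg form) scl V \<pi>"
    and central: "has_central_character \<psi> scl V \<pi>"
begin

lemma rep_mult: "x \<in> V \<Longrightarrow> \<pi> (w, t) (\<pi> (w', t') x) = \<pi> (w + w', t + t' + form w w' / 2) x"
  using rep by (simp add: group_rep_def heisenberg_simps(1) heisenberg_simps(3) [symmetric])

lemma rep_in: "x \<in> V \<Longrightarrow> \<pi> g x \<in> V"
  using rep by (cases g) (simp add: group_rep_def heisenberg_simps)

lemma rep_central: "x \<in> V \<Longrightarrow> \<pi> (w, s + t) x = scl (\<psi> s) (\<pi> (w, t) x)"
  using rep_mult[of x 0 s w t] central rep_in[of x "(w, t)"]
  by (simp add: has_central_character_def form_zero)

lemma twisted_rep_of_rep: "twisted_rep \<kappa> (lattice D E) scl V (\<lambda>w. \<pi> (w, q w))"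
proof -
  interpret R: vector_space scl using rep by (simp add: group_rep_def)
  show ?thesis
  proof unfold_locales
    show "R.subspace V" using rep by (simp add: group_rep_def)
    fix x w w' assume x: "x \<in> V"
    show "\<pi> (w, q w) (\<pi> (w', q w') x) = scl (\<kappa> w w') (\<pi> (w + w', q (w + w')) x)"
      using rep_central[OF x, of "w + w'" "- \<beta> w w'" "q (w + w')"]
      by (simp add: rep_mult[OF x] q_add \<kappa>_def)
  qed (use rep in \<open>simp_all add: group_rep_def heisenberg_simps q_zero\<close>)
qed

lemma rep_eq: "x \<in> V \<Longrightarrow> \<pi> (w, t) x = scl (\<psi> (t - q w)) (\<pi> (w, q w) x)"
  using rep_central[of x w "t - q w" "q w"] by simp

text \<open>By \<open>rep_eq\<close> the operators at \<open>(w, t)\<close> and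
  \<open>(w, q w)\<close> differ by a scalar, so they preserve the same subspaces.\<close>

lemma irreducible_iff:
  "irreducible_rep (heisenberg form) scl V \<pi> \<longleftrightarrow>
    twisted_rep.irreducible scl V (\<lambda>w. \<pi> (w, q w))"
proof -
  interpret R: twisted_rep \<kappa> "lattice D E" scl V "\<lambda>w. \<pi> (w, q w)" by (rule twisted_rep_of_rep)
  have "R.stable U \<longleftrightarrow> U \<subseteq> V \<and> R.subspace U \<and> (\<forall>g\<in>carrier (heisenberg form). \<forall>x\<in>U. \<pi> g x \<in> U)" for U
  proof
    assume U: "R.stable U"
    have "\<pi> (w, t) x \<in> U" if "x \<in> U" for w t x
    proof -
      have "x \<in> V" using U that by (auto simp: R.stable_def)
      then show ?thesis
        using U that by (subst rep_eq) (simp_all add: R.stable_def R.subspace_scale)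
    qed
    then show "U \<subseteq> V \<and> R.subspace U \<and> (\<forall>g\<in>carrier (heisenberg form). \<forall>x\<in>U. \<pi> g x \<in> U)"
      using U by (simp add: R.stable_def heisenberg_simps split_paired_all)
  qed (simp add: R.stable_def heisenberg_simps)
  then show ?thesis unfolding irreducible_rep_def R.irreducible_def by simp
qed

text \<open>The level \<open>M\<close> is taken so small that \<open>(w, 0)\<close> lies in a box
  fixing \<open>x\<close> and that \<open>\<psi> (q w) = 1\<close>; then \<open>(w, q w)\<close>
  fixes \<open>x\<close> as well.\<close>

lemma smooth_twisted:
  assumes open_stab: "\<And>x. x \<in> V \<Longrightarrow>
    openin (heisenberg_topology scaleW B T) {g \<in> carrier (heisenberg form). \<pi> g x = x}"
  shows "twisted_rep.smooth \<kappa> (lattice D E) V (\<lambda>w. \<pi> (w, q w))"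
proof -
  interpret R: twisted_rep \<kappa> "lattice D E" scl V "\<lambda>w. \<pi> (w, q w)" by (rule twisted_rep_of_rep)
  show ?thesis
    unfolding R.smooth_def
  proof
    fix x assume x: "x \<in> V"
    have "\<pi> (0, 0) x = x" using rep x by (simp add: group_rep_def heisenberg_simps)
    with box_in_open[OF open_stab[OF x]] obtain U
      where U: "openin T U" "0 \<in> U" "box U \<subseteq> {g. \<pi> g x = x}"
      by (auto simp: heisenberg_simps)
    obtain N where N: "openin T N" "0 \<in> N" "\<forall>w\<in>lattice N N. \<forall>b\<in>B. representation B w b \<in> U"
      using small_coordinates[OF U(1,2)] by (elim exE conjE)
    obtain N' where N': "openin T N'" "0 \<in> N'" "\<forall>y\<in>N'. y / 2 \<in> E"
      using half_E_open by (elim exE conjE)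
    have "openin T (N \<inter> N')" "0 \<in> N \<inter> N'" using N N' by auto
    from small_finite_level[OF this] obtain M
      where M: "finite_level M" "M \<subseteq> lattice (D \<inter> (N \<inter> N')) (E \<inter> (N \<inter> N'))" by (elim exE conjE)
    have "\<pi> (w, q w) x = x" if w: "w \<in> M" for w
    proof -
      have w': "form w (f i) \<in> D" "form w (f i) \<in> N" "form (e i) w \<in> N" "form (e i) w \<in> N'" if "i < n" for i
        using w M(2) that by (auto simp: lattice_def)
      have "w \<in> lattice N N" using w' by (simp add: lattice_def)
      then have "(w, 0) \<in> box U" using N(3) U(2) by (simp add: box_def)
      then have "\<pi> (w, 0) x = x" using U(3) by blast
      moreover have "\<psi> (q w) = 1" using w' N'(3) by (intro psi_q_trivial) auto
      ultimately show ?thesis using rep_central[OF x, of w "q w" 0] by simp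
    qed
    then show "\<exists>M. finite_level M \<and> (\<forall>m\<in>M. \<pi> (m, q m) x = x)" using M(1) by blast
  qed
qed

text \<open>Invariance under one box spreads over the stabilizer by left translation. The group law
  shears the central coordinate by a form term, which \<open>small_form\<close> keeps small.\<close>

lemma open_stabilizer:
  assumes x: "x \<in> V" and U: "openin T U" "0 \<in> U" "\<And>g. g \<in> box U \<Longrightarrow> \<pi> g x = x"
  shows "openin (heisenberg_topology scaleW B T) {g \<in> carrier (heisenberg form). \<pi> g x = x}"
proof (subst openin_subopen, intro ballI)
  fix g assume "g \<in> {g \<in> carrier (heisenberg form). \<pi> g x = x}"
  then obtain w t where g: "g = (w, t)" "\<pi> (w, t) x = x" by (cases g) auto
  obtain U' where U': "openin T U'" "add_subgroup U'" "U' \<subseteq> U"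
    using small_subgroup[OF U(1,2)] by (elim exE conjE)
  have "finite {scaleW (1 / 2) w}" by simp
  from small_form[OF this U'(1) add_subgroupD(1)[OF U'(2)]] obtain N
    where N: "openin T N" "0 \<in> N" "N \<subseteq> U'"
      "\<forall>w'. (\<forall>b\<in>B. representation B w' b \<in> N) \<longrightarrow> (\<forall>z\<in>{scaleW (1 / 2) w}. form w' z \<in> U')"
    by (elim exE conjE)
  let ?S = "{(w', t'). (w' - w, t' - t) \<in> box N}"
  have "\<pi> (w', t') x = x" if h: "(w' - w, t' - t) \<in> box N" for w' t'
  proof -
    \<comment> \<open>The central coordinate for which \<open>(w', t')\<close> is the product of
      \<open>(w, t)\<close> and \<open>(w' - w, ?s)\<close>; its sign comes from
      antisymmetry.\<close>
    let ?s = "t' - t + form (w' - w) (scaleW (1 / 2) w)"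
    have "form (w' - w) (scaleW (1 / 2) w) \<in> U'" using N(4) h by (auto simp: box_def)
    moreover have "t' - t \<in> U'" using h N(3) by (auto simp: box_def)
    ultimately have "?s \<in> U'" by (intro add_subgroupD(4)[OF U'(2)])
    then have "(w' - w, ?s) \<in> box U" using h N(3) U'(3) by (auto simp: box_def)
    then have "\<pi> (w' - w, ?s) x = x" by (rule U(3))
    then have "x = \<pi> (w, t) (\<pi> (w' - w, ?s) x)" using g by simp
    also have "\<dots> = \<pi> (w + (w' - w), t + ?s + form w (w' - w) / 2) x" by (rule rep_mult[OF x])
    also have "t + ?s + form w (w' - w) / 2 = t'"
      by (simp add: form_bilinear form_commute[of w "w' - w"])
    finally show ?thesis by simp
  qed
  then have "?S \<subseteq> {g \<in> carrier (heisenberg form). \<pi> g x = x}" by (auto simp: heisenberg_simps)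
  moreover have "g \<in> ?S" using N(2) by (simp add: g box_def representation_zero)
  ultimately show "\<exists>S. openin (heisenberg_topology scaleW B T) S \<and> g \<in> S \<and>
      S \<subseteq> {g \<in> carrier (heisenberg form). \<pi> g x = x}"
    using open_translated_box[OF N(1,2), of w t] by blast
qed

end

end

section \<open>Existence and uniqueness\<close>

context heisenberg_lattice begin

text \<open>Inverse of \<open>twisted_rep_of_rep\<close>; the formula for \<rho> is forced by
  \<open>rep_eq\<close>.\<close>

lemma rep_of_twisted_rep:
  assumes "twisted_rep \<kappa> (lattice D E) scl V A"
  defines "\<rho> \<equiv> \<lambda>(w, t) x. scl (\<psi> (t - q w)) (A w x)"
  shows "group_rep (heisenberg form) scl V \<rho>" "has_central_character \<psi> scl V \<rho>"
    "(\<lambda>w. \<rho> (w, q w)) = A"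
proof -
  interpret R: twisted_rep \<kappa> "lattice D E" scl V A by (rule assms(1))
  have mult: "\<rho> (g \<otimes>\<^bsub>heisenberg form\<^esub> h) x = \<rho> g (\<rho> h x)" if x: "x \<in> V" for g h x
  proof -
    obtain w t w' t' where gh: "g = (w, t)" "h = (w', t')" by (cases g, cases h)
    have "t + t' + form w w' / 2 - q (w + w') = (t - q w) + (t' - q w') + - \<beta> w w'"
      using q_add[of w w'] by (simp add: algebra_simps)
    then have "\<psi> (t + t' + form w w' / 2 - q (w + w')) = \<psi> (t - q w) * \<psi> (t' - q w') * \<kappa> w w'"
      unfolding \<kappa>_def psi_add [symmetric] by (rule arg_cong)
    then show ?thesis using x by (simp add: gh heisenberg_simps \<rho>_def R.A_scale R.A_in R.A_mult)
  qed
  show "group_rep (heisenberg form) scl V \<rho>"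
    unfolding group_rep_def
  proof (intro conjI ballI allI)
    show "vector_space scl" by unfold_locales
    show "R.subspace V" by (rule R.V_subspace)
    show "\<rho> \<one>\<^bsub>heisenberg form\<^esub> x = x" if "x \<in> V" for x
      using that by (simp add: heisenberg_simps \<rho>_def q_zero psi_0 R.A_zero)
    show "\<rho> (g \<otimes>\<^bsub>heisenberg form\<^esub> h) x = \<rho> g (\<rho> h x)" if "x \<in> V" for g h x
      using that by (rule mult)
  qed (auto simp: \<rho>_def split_beta R.A_in R.A_add R.A_scale R.V_subspace R.subspace_scale
      R.scale_right_distrib mult.commute)
  show "has_central_character \<psi> scl V \<rho>"
    by (simp add: has_central_character_def \<rho>_def q_zero R.A_zero)
  show "(\<lambda>w. \<rho> (w, q w)) = A" by (simp add: \<rho>_def psi_0)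
qed

text \<open>The second component of the argument plays no role: functions on \<open>W\<close> are viewed as functions on
  the Heisenberg group that are constant along the centre.\<close>

definition shift :: "'w \<Rightarrow> ('w \<times> 'f \<Rightarrow> 'r) \<Rightarrow> 'w \<times> 'f \<Rightarrow> 'r" where
  "shift w \<phi> = (\<lambda>(z, s). \<kappa> z w * \<phi> (z + w, s))"

definition vacuum :: "'w \<times> 'f \<Rightarrow> 'r" where
  "vacuum = (\<lambda>(z, s). if z \<in> lattice D E then 1 else 0)"

lemma twisted_rep_shift: "twisted_rep \<kappa> (lattice D E) fun_scale UNIV shift"
proof -
  have "vector_space (fun_scale :: 'r \<Rightarrow> ('w \<times> 'f \<Rightarrow> 'r) \<Rightarrow> 'w \<times> 'f \<Rightarrow> 'r)"
    by unfold_locales (auto simp: fun_scale_def fun_eq_iff algebra_simps)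
  then interpret R: vector_space "fun_scale :: 'r \<Rightarrow> ('w \<times> 'f \<Rightarrow> 'r) \<Rightarrow> 'w \<times> 'f \<Rightarrow> 'r" .
  have k0: "\<kappa> z 0 = 1" for z by (simp add: \<kappa>_def beta_zero psi_0)
  show ?thesis
    by unfold_locales
      (auto simp: shift_def fun_scale_def fun_eq_iff distrib_left k0 add_left add_right mult_ac add.assoc)
qed

text \<open>The span of the translates of \<open>vacuum\<close> consists of functions supported over
  finitely many cosets of the lattice, as in compact induction. This makes \<open>vacuum\<close> a
  cyclic fixed vector, and smoothness need only be checked on its translates.\<close>

lemma exists_irreducible:
  "\<exists>(S :: ('w \<times> 'f \<Rightarrow> 'r) set) \<rho>. irreducible_heisenberg_rep scaleW B T form \<psi> fun_scale S \<rho>"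
proof -
  interpret F: twisted_rep \<kappa> "lattice D E" fun_scale UNIV shift by (rule twisted_rep_shift)
  have vac: "F.fixed vacuum"
  proof -
    have "shift l vacuum = vacuum" if l: "l \<in> lattice D E" for l
    proof
      fix h :: "'w \<times> 'f"
      obtain z s where h: "h = (z, s)" by (cases h)
      have "z + l \<in> lattice D E \<longleftrightarrow> z \<in> lattice D E"
        using L_add[OF _ l, of z] L_diff[OF _ l, of "z + l"] by auto
      then show "shift l vacuum h = vacuum h"
        using trivial_on_L[OF _ l, of z] by (simp add: h shift_def vacuum_def)
    qed
    then show ?thesis by (simp add: F.fixed_def)
  qed
  have vac0: "vacuum \<noteq> 0"
    using L_zero by (auto simp: vacuum_def fun_eq_iff)
  define S where "S = F.span (F.orbit vacuum)"
  have "F.stable S" unfolding S_def by (rule F.stable_span_orbit) simp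
  then interpret S: twisted_rep \<kappa> "lattice D E" fun_scale S shift by (rule F.twisted_rep_stable)
  define \<rho> where "\<rho> = (\<lambda>(w, t) x. fun_scale (\<psi> (t - q w)) (shift w x))"
  have rep: "group_rep (heisenberg form) fun_scale S \<rho>" and cent: "has_central_character \<psi> fun_scale S \<rho>"
    and \<rho>_q: "(\<lambda>w. \<rho> (w, q w)) = shift"
    unfolding \<rho>_def by (rule rep_of_twisted_rep[OF S.twisted_rep_axioms])+
  have vacS: "vacuum \<in> S" unfolding S_def by (rule F.orbit_base) simp
  define P where "P x \<longleftrightarrow> (\<exists>U. openin T U \<and> 0 \<in> U \<and> (\<forall>g\<in>box U. \<rho> g x = x))" for x
  have orbitP: "P (shift w0 vacuum)" for w0
  proof -
    obtain U1 where U1: "openin T U1" "0 \<in> U1" "\<forall>y\<in>U1. \<psi> y = 1"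
      using psi_locally_trivial by (elim exE conjE)
    obtain U2 where U2: "openin T U2" "0 \<in> U2" "U2 \<subseteq> D" using D_open by (elim exE conjE)
    obtain U3 where U3: "openin T U3" "0 \<in> U3" "U3 \<subseteq> E" using E_open by (elim exE conjE)
    obtain U4 where U4: "openin T U4" "0 \<in> U4" "\<forall>y\<in>U4. y / 2 \<in> E"
      using half_E_open by (elim exE conjE)
    \<comment> \<open>\<open>U1\<close> trivializes \<open>\<psi>\<close> on \<open>t\<close> and on
      \<open>form w w0\<close>; \<open>U2\<close> and \<open>U3\<close> put \<open>w\<close> in the
      lattice; \<open>U2\<close> and \<open>U4\<close> give \<open>\<psi> (q w) = 1\<close>. In
      \<open>?Z\<close>, the vectors \<open>f i\<close> and \<open>- e i\<close> yield the
      coordinates of \<open>w\<close>, since \<open>form w (- e i) = form (e i) w\<close>.\<close>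
    let ?U = "U1 \<inter> U2 \<inter> U3 \<inter> U4"
    let ?Z = "insert w0 (f ` {..<n} \<union> (\<lambda>i. - e i) ` {..<n})"
    have U: "openin T ?U" "0 \<in> ?U" using U1 U2 U3 U4 by auto
    have "finite ?Z" by simp
    from small_form[OF this U] obtain N where N: "openin T N" "0 \<in> N" "N \<subseteq> ?U"
      "\<forall>w. (\<forall>b\<in>B. representation B w b \<in> N) \<longrightarrow> (\<forall>z\<in>?Z. form w z \<in> ?U)"
      by (elim exE conjE)
    have "\<rho> (w, t) (shift w0 vacuum) = shift w0 vacuum" if h: "(w, t) \<in> box N" for w t
    proof -
      have "\<forall>b\<in>B. representation B w b \<in> N" using h by (simp add: box_def)
      from N(4) [rule_format, OF this [rule_format]]
      have z: "form w z \<in> ?U" if "z \<in> ?Z" for z using that by blast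
      have fU: "form w (f i) \<in> ?U" "form (e i) w \<in> ?U" if "i < n" for i
        using z[of "f i"] z[of "- e i"] that by (simp_all add: form_uminus form_commute[of w "e i"])
      have wL: "w \<in> lattice D E" using fU U2(3) U3(3) by (auto simp: lattice_def)
      have "\<psi> (q w) = 1" using fU U2(3) U4(3) by (intro psi_q_trivial) auto
      moreover have "\<psi> t = 1" using h N(3) U1(3) by (auto simp: box_def)
      ultimately have "\<psi> (t - q w) = 1" by (simp add: psi_diff)
      moreover have "comm w w0 = 1" using z[of w0] U1(3) by (simp add: comm_eq_psi)
      ultimately show ?thesis
        using F.A_comm[of vacuum w w0] vac wL by (simp add: \<rho>_def F.fixed_def)
    qed
    then show ?thesis unfolding P_def using N(1,2) by (intro exI[of _ N]) auto
  qed
  have subP: "F.subspace {x \<in> S. P x}"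
    unfolding F.subspace_def
  proof (intro conjI ballI allI)
    have S_sub: "F.subspace S" by (rule S.V_subspace)
    have "\<rho> g 0 = 0" for g using F.A_0 by (simp add: \<rho>_def split_beta)
    then have "P 0" unfolding P_def using openin_topspace[of T] topspace by auto
    then show "0 \<in> {x \<in> S. P x}" using F.subspace_0[OF S_sub] by simp
    fix x assume x: "x \<in> {x \<in> S. P x}"
    then obtain U where U: "openin T U" "0 \<in> U" "\<forall>g\<in>box U. \<rho> g x = x" unfolding P_def by auto
    {
      fix y assume y: "y \<in> {x \<in> S. P x}"
      then obtain U' where U': "openin T U'" "0 \<in> U'" "\<forall>g\<in>box U'. \<rho> g y = y" unfolding P_def by auto
      have "\<rho> g (x + y) = x + y" if g: "g \<in> box (U \<inter> U')" for g
      proof -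
        have "g \<in> box U" "g \<in> box U'" using g by (auto simp: box_def)
        moreover have "\<rho> g (x + y) = \<rho> g x + \<rho> g y"
          using rep x y by (cases g) (simp add: group_rep_def heisenberg_simps)
        ultimately show ?thesis using U(3) U'(3) by simp
      qed
      moreover have "openin T (U \<inter> U')" "0 \<in> U \<inter> U'" using U U' by auto
      ultimately have "P (x + y)" unfolding P_def by blast
      then show "x + y \<in> {x \<in> S. P x}" using x y F.subspace_add[OF S_sub] by simp
    next
      fix c
      have "\<rho> g (fun_scale c x) = fun_scale c (\<rho> g x)" for g
        using rep x by (cases g) (simp add: group_rep_def heisenberg_simps)
      then have "P (fun_scale c x)" unfolding P_def using U by (intro exI[of _ U]) simp
      then show "fun_scale c x \<in> {x \<in> S. P x}" using x F.subspace_scale[OF S_sub] by simp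
    }
  qed
  have "F.orbit vacuum \<subseteq> {x \<in> S. P x}"
    using orbitP vacS S.A_in by (auto simp: F.orbit_def)
  then have allP: "P x" if "x \<in> S" for x
    using F.span_minimal[OF _ subP] that unfolding S_def by blast
  have open_stab: "openin (heisenberg_topology scaleW B T) {g \<in> carrier (heisenberg form). \<rho> g x = x}"
    if x: "x \<in> S" for x
  proof -
    obtain U where "openin T U" "0 \<in> U" "\<forall>g\<in>box U. \<rho> g x = x"
      using allP[OF x] unfolding P_def by (elim exE conjE)
    then show ?thesis by (intro open_stabilizer[OF rep cent x]) auto
  qed
  have "S.smooth" using smooth_twisted[OF rep cent open_stab] unfolding \<rho>_q .
  moreover have "S.fixed vacuum" using vac vacS by (simp add: S.fixed_def F.fixed_def)
  moreover have "S = F.span (S.orbit vacuum)" unfolding S_def S.orbit_def F.orbit_def ..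
  ultimately have "S.irreducible" using vac0 by (intro S.irreducible_span_orbit)
  then have "irreducible_rep (heisenberg form) fun_scale S \<rho>"
    using irreducible_iff[OF rep cent] unfolding \<rho>_q by simp
  then have "irreducible_heisenberg_rep scaleW B T form \<psi> fun_scale S \<rho>"
    using rep cent open_stab by (simp add: irreducible_heisenberg_rep_def smooth_rep_def)
  then show ?thesis by blast
qed

lemma irreducible_unique:
  fixes scl1 :: "'r \<Rightarrow> 'u::ab_group_add \<Rightarrow> 'u" and scl2 :: "'r \<Rightarrow> 'v::ab_group_add \<Rightarrow> 'v"
  assumes 1: "irreducible_heisenberg_rep scaleW B T form \<psi> scl1 V1 \<pi>1"
    and 2: "irreducible_heisenberg_rep scaleW B T form \<psi> scl2 V2 \<pi>2"
  shows "isomorphic_reps (heisenberg form) scl1 V1 \<pi>1 scl2 V2 \<pi>2"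
proof -
  have r1: "group_rep (heisenberg form) scl1 V1 \<pi>1" "has_central_character \<psi> scl1 V1 \<pi>1"
    and r2: "group_rep (heisenberg form) scl2 V2 \<pi>2" "has_central_character \<psi> scl2 V2 \<pi>2"
    using 1 2 by (simp_all add: irreducible_heisenberg_rep_def smooth_rep_def)
  have "\<exists>f. bij_betw f V1 V2 \<and> (\<forall>x\<in>V1. \<forall>y\<in>V1. f (x + y) = f x + f y) \<and>
    (\<forall>c. \<forall>x\<in>V1. f (scl1 c x) = scl2 c (f x)) \<and>
    (\<forall>w. \<forall>x\<in>V1. f (\<pi>1 (w, q w) x) = \<pi>2 (w, q w) (f x))"
  proof (rule irreducible_twisted_reps_isomorphic)
    show "twisted_rep \<kappa> (lattice D E) scl1 V1 (\<lambda>w. \<pi>1 (w, q w))" by (rule twisted_rep_of_rep[OF r1])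
    show "twisted_rep \<kappa> (lattice D E) scl2 V2 (\<lambda>w. \<pi>2 (w, q w))" by (rule twisted_rep_of_rep[OF r2])
    show "twisted_rep.irreducible scl1 V1 (\<lambda>w. \<pi>1 (w, q w))"
      using irreducible_iff[OF r1] 1 by (simp add: irreducible_heisenberg_rep_def)
    show "twisted_rep.irreducible scl2 V2 (\<lambda>w. \<pi>2 (w, q w))"
      using irreducible_iff[OF r2] 2 by (simp add: irreducible_heisenberg_rep_def)
    show "twisted_rep.smooth \<kappa> (lattice D E) V1 (\<lambda>w. \<pi>1 (w, q w))"
      using 1 by (intro smooth_twisted[OF r1]) (simp add: irreducible_heisenberg_rep_def smooth_rep_def)
    show "twisted_rep.smooth \<kappa> (lattice D E) V2 (\<lambda>w. \<pi>2 (w, q w))"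
      using 2 by (intro smooth_twisted[OF r2]) (simp add: irreducible_heisenberg_rep_def smooth_rep_def)
  qed
  then obtain F where F: "bij_betw F V1 V2" "\<forall>x\<in>V1. \<forall>y\<in>V1. F (x + y) = F x + F y"
    "\<forall>c. \<forall>x\<in>V1. F (scl1 c x) = scl2 c (F x)" "\<forall>w. \<forall>x\<in>V1. F (\<pi>1 (w, q w) x) = \<pi>2 (w, q w) (F x)"
    by (elim exE conjE)
  \<comment> \<open>By \<open>rep_eq\<close> both actions of \<open>(w, t)\<close> arise from those
    of \<open>(w, q w)\<close> by the same scalar \<open>\<psi> (t - q w)\<close>, which passes
    through \<open>F\<close>.\<close>
  have "F (\<pi>1 g x) = \<pi>2 g (F x)" if x: "x \<in> V1" for g x
  proof -
    obtain w t where g: "g = (w, t)" by (cases g)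
    have "F x \<in> V2" using F(1) x by (rule bij_betwE[THEN bspec])
    then show ?thesis
      using F(3,4) x rep_in[OF r1 x, of "(w, q w)"] rep_eq[OF r1 x, of w t] rep_eq[OF r2, of "F x" w t]
      by (simp add: g)
  qed
  then show ?thesis unfolding isomorphic_reps_def using F by (intro exI[of _ F]) simp
qed

end

theorem mainTheorem1:
  fixes T :: "'f::field topology" and p l :: nat
    and scaleW :: "'f \<Rightarrow> 'w::ab_group_add \<Rightarrow> 'w" and B :: "'w set"
    and form :: "'w \<Rightarrow> 'w \<Rightarrow> 'f"
    and \<psi> :: "'f \<Rightarrow> 'r::field"
  assumes F: "base_field T p" and F_char: "CHAR('f) \<noteq> 2"
    and W: "finite_dimensional_vector_space scaleW B" "symplectic_form scaleW form"
    and R_char: "CHAR('r) = l"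
    and psi: "smooth_character T \<psi>" "\<exists>t. \<psi> t \<noteq> 1"
  shows
    "(\<exists>(S :: ('w \<times> 'f \<Rightarrow> 'r) set) \<rho>.
        irreducible_heisenberg_rep scaleW B T form \<psi> fun_scale S \<rho>) \<and>
     (\<forall>(scale1 :: 'r \<Rightarrow> 'u::ab_group_add \<Rightarrow> 'u) V1 \<pi>1
        (scale2 :: 'r \<Rightarrow> 'v::ab_group_add \<Rightarrow> 'v) V2 \<pi>2.
        irreducible_heisenberg_rep scaleW B T form \<psi> scale1 V1 \<pi>1 \<longrightarrow>
        irreducible_heisenberg_rep scaleW B T form \<psi> scale2 V2 \<pi>2 \<longrightarrow>
        isomorphic_reps (heisenberg form) scale1 V1 \<pi>1 scale2 V2 \<pi>2)"
proof -
  have two: "(2 :: 'f) \<noteq> 0"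
  proof
    assume "(2 :: 'f) = 0"
    then have "CHAR('f) dvd 2" using of_nat_eq_0_iff_char_dvd[where 'a = 'f, of 2] by simp
    then have "CHAR('f) = 1 \<or> CHAR('f) = 2" using two_is_prime_nat prime_nat_iff by blast
    then show False using F_char by simp
  qed
  obtain t where "\<psi> t \<noteq> 1" using psi(2) ..
  then obtain D E where "dual_lattices T \<psi> D E"
    by (rule dual_lattices_base_field[OF F psi(1)])
  then interpret dual_lattices T \<psi> D E .
  interpret finite_dimensional_vector_space scaleW B by (rule W(1))
  interpret symplectic scaleW B form by unfold_locales (rule W(2))
  obtain n e f where h: "hyperbolic n e f"
    "\<forall>w. w = (\<Sum>i<n. scaleW (form w (f i)) (e i)) + (\<Sum>i<n. scaleW (form (e i) w) (f i))"
    using symplectic_basis by (elim exE conjE)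
  interpret heisenberg_lattice scaleW B form T \<psi> D E n e f
    by unfold_locales (rule two, rule h(1), rule h(2) [rule_format])
  show ?thesis using exists_irreducible irreducible_unique by blast
qed

end
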